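(* Let $A, B \in \mathbb{B}(\mathscr{H})$ be positive invertible operators and $\Phi: \mathbb{B}(\mathscr{H}) \to \mathbb{B}(\mathscr{K})$ be a positive linear map. (i) If $m^2A \leq B \leq M^2A$ for some positive real numbers $m<M$, then the following inequalities hold: (i.a) (operator Diaz--Metcalf inequality of first type) $$Mm\,\Phi(A)+\Phi(B) \leq (M+m)\,\Phi(A\,\sharp\, B);$$ (i.b) (operator Cassels inequality) $$\Phi(A)\,\sharp\, \Phi(B) \leq \frac{M+m}{2\sqrt{Mm}}\,\Phi(A\,\sharp\, B);$$ (i.c) (operator Klamkin--McLenaghan inequality) $$\Phi(A\,\sharp\, B)^{-\frac{1}{2}}\Phi(B)\Phi(A\,\sharp\, B)^{-\frac{1}{2}}- \Phi(A\,\sharp\, B)^{\frac{1}{2}}\Phi(A)^{-1}\Phi(A\,\sharp\, B)^{\frac{1}{2}}\leq (\sqrt{M}-\sqrt{m})^2;$$ (i.d) (operator Kantorovich inequality) $$\Phi(A)\,\sharp\, \Phi(A^{-1}) \leq \frac{M^2+m^2}{2Mm}.$$ (ii) If $m_1^2 \leq A \leq M_1^2$ and $m_2^2\leq B\leq M_2^2$ for some positive real numbers $m_1<M_1$ and $m_2 <M_2$, then the following inequalities hold: (ii.a) (operator Diaz--Metcalf inequality of second type) $$\frac{M_2m_2}{M_1m_1}\Phi(A)+\Phi(B) \leq \left(\frac{M_2}{m_1}+\frac{m_2}{M_1}\right)\Phi(A\,\sharp\, B);$$ (ii.b) (operator P\'olya--Szeg\"o inequality) $$\Phi(A)\,\sharp\,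 \Phi(B) \leq \frac{1}{2}\left(\sqrt{\frac{M_1M_2}{m_1m_2}}+\sqrt{\frac{m_1m_2}{M_1M_2}}\right)\Phi(A\,\sharp\, B);$$ (ii.c) (operator Shisha--Mond inequality) $$\Phi(A\,\sharp\, B)^{-\frac{1}{2}}\Phi(B)\Phi(A\,\sharp\, B)^{-\frac{1}{2}}- \Phi(A\,\sharp\, B)^{\frac{1}{2}}\Phi(A)^{-1}\Phi(A\,\sharp\, B)^{\frac{1}{2}} \leq \left(\sqrt{\frac{M_2}{m_1}}-\sqrt{\frac{m_2}{M_1}}\right)^2;$$ (ii.d) (operator Gr\"uss type inequality) $$\Phi(A)\,\sharp\, \Phi(B)- \Phi(A\,\sharp\, B)\leq \frac{\sqrt{M_1M_2}\left(\sqrt{M_1M_2}-\sqrt{m_1m_2}\right)^2}{2\sqrt{m_1m_2}}\min\left\{\frac{M_1}{m_1}, \frac{M_2}{m_2}\right\}.$$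
   Context: $\mathscr{H}$ and $\mathscr{K}$ are Hilbert spaces, and $\mathbb{B}(\mathscr{H})$ is the algebra of all bounded linear operators acting on $\mathscr{H}$. A scalar $\alpha$ also denotes the scalar multiple $\alpha I$ of the identity operator $I$. For self-adjoint operators $A,B$, the relation $B\le A$ means $\langle B\xi,\xi\rangle\le\langle A\xi,\xi\rangle$ for all vectors $\xi$; $A$ is called positive if $0\le A$; $0<A$ means that $A$ is positive and invertible. A linear map $\Phi$ between $C^*$-algebras is positive if $\Phi(A)$ is positive whenever $A$ is. For positive operators $A,B$ with $0<A$, the geometric operator mean is $A\,\sharp\,B = A^{1/2}\left(A^{-1/2}BA^{-1/2}\right)^{1/2}A^{1/2}$.
   Formalization: (i.d) and (ii.d) fail for general Φ (e.g. large multiples of a trace), so both assume Φ(I) ≤ I; (i.d) also fails for arbitrary B, so it assumes either m² ≤ A ≤ M², or B = A⁻¹ with m²A ≤ B ≤ M²A. *)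

theory Defs
  imports "HOL-Analysis.Analysis"
begin

section \<open>Complex Hilbert spaces\<close>

class scaleC =
  fixes scaleC :: "complex \<Rightarrow> 'a \<Rightarrow> 'a"  (infixr \<open>*\<^sub>C\<close> 75)

class complex_vector = real_vector + scaleC +
  assumes scaleC_add_right: "a *\<^sub>C (x + y) = a *\<^sub>C x + a *\<^sub>C y"
    and scaleC_add_left: "(a + b) *\<^sub>C x = a *\<^sub>C x + b *\<^sub>C x"
    and scaleC_scaleC: "a *\<^sub>C (b *\<^sub>C x) = (a * b) *\<^sub>C x"
    and scaleR_scaleC: "r *\<^sub>R x = complex_of_real r *\<^sub>C x"

text \<open>The inner product is linear in its first argument. Its real part is the inner product of the
  underlying real space, so that norm and topology are those of \<^class>\<open>real_inner\<close>; positive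
  definiteness is inherited from there.\<close>

class complex_inner = real_inner + complex_vector +
  fixes cinner :: "'a \<Rightarrow> 'a \<Rightarrow> complex"
  assumes cinner_commute: "cinner x y = cnj (cinner y x)"
    and cinner_add_left: "cinner (x + y) z = cinner x z + cinner y z"
    and cinner_scaleC_left: "cinner (a *\<^sub>C x) y = a * cinner x y"
    and inner_eq_Re_cinner: "inner x y = Re (cinner x y)"

class chilbert_space = complex_inner + complete_space

instantiation complex :: chilbert_space
begin
definition scaleC_complex :: "complex \<Rightarrow> complex \<Rightarrow> complex"
  where "scaleC_complex a x = a * x"
definition cinner_complex :: "complex \<Rightarrow> complex \<Rightarrow> complex"
  where "cinner_complex x y = x * cnj y"
instance
  by standard
    (simp_all add: scaleC_complex_def cinner_complex_def inner_complex_def algebra_simps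
      scaleR_conv_of_real)
end


section \<open>The algebra of bounded complex-linear operators\<close>

typedef (overloaded) 'a bop =
  "{T :: 'a::complex_inner \<Rightarrow>\<^sub>L 'a. \<forall>c x. blinfun_apply T (c *\<^sub>C x) = c *\<^sub>C blinfun_apply T x}"
  morphisms blinfun_of_bop Abs_bop
proof
  show "id_blinfun \<in> {T :: 'a \<Rightarrow>\<^sub>L 'a. \<forall>c x. blinfun_apply T (c *\<^sub>C x) = c *\<^sub>C blinfun_apply T x}"
    by simp
qed

setup_lifting type_definition_bop

definition bop_apply :: "'a::complex_inner bop \<Rightarrow> 'a \<Rightarrow> 'a"
  where "bop_apply T x = blinfun_apply (blinfun_of_bop T) x"

lemma scaleC_zero_right [simp]: "c *\<^sub>C (0::'a::complex_vector) = 0"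
  using scaleC_add_right[of c "0::'a" 0] by simp

lemma scaleC_minus_right: "c *\<^sub>C (- x) = - (c *\<^sub>C (x::'a::complex_vector))"
  using scaleC_add_right[of c x "- x"] by (simp add: eq_neg_iff_add_eq_0 add.commute)

lemma scaleC_diff_right: "c *\<^sub>C (x - y) = c *\<^sub>C x - c *\<^sub>C (y::'a::complex_vector)"
  using scaleC_add_right[of c x "- y"] by (simp add: scaleC_minus_right)

lemma scaleC_scaleR_commute: "c *\<^sub>C (r *\<^sub>R x) = r *\<^sub>R (c *\<^sub>C (x::'a::complex_vector))"
  by (simp add: scaleR_scaleC scaleC_scaleC mult.commute)

lemma norm_scaleC: "norm (c *\<^sub>C x) = cmod c * norm (x::'a::complex_inner)"
proof -
  have xx: "cinner x x = complex_of_real (inner x x)"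
    using cinner_commute[of x x] by (simp add: inner_eq_Re_cinner complex_eq_iff)
  have "cinner (c *\<^sub>C x) (c *\<^sub>C x) = c * cnj (cinner (c *\<^sub>C x) x)"
    using cinner_commute[of x "c *\<^sub>C x"] by (simp add: cinner_scaleC_left)
  also have "\<dots> = (c * cnj c) * cinner x x"
    by (simp add: cinner_scaleC_left xx)
  also have "\<dots> = complex_of_real ((cmod c)\<^sup>2 * inner x x)"
    by (simp add: xx complex_norm_square[symmetric])
  finally have "inner (c *\<^sub>C x) (c *\<^sub>C x) = (cmod c)\<^sup>2 * inner x x"
    by (simp add: inner_eq_Re_cinner[of "c *\<^sub>C x"])
  then show ?thesis
    by (simp add: norm_eq_sqrt_inner real_sqrt_mult)
qed

lemma bounded_linear_scaleC: "bounded_linear (\<lambda>x. c *\<^sub>C (x::'a::complex_inner))"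
  by (rule bounded_linear_intro[where K = "cmod c"])
    (simp_all add: scaleC_add_right scaleC_scaleR_commute norm_scaleC mult.commute)

text \<open>Multiplication is composition and \<^term>\<open>1\<close> is the identity operator. The class
  \<open>ring_1\<close> is avoided because it excludes the zero space.\<close>

instantiation bop :: (complex_inner) "{real_algebra, monoid_mult, complex_vector}"
begin

lift_definition zero_bop :: "'a bop" is 0 by simp
lift_definition one_bop :: "'a bop" is id_blinfun by simp
lift_definition plus_bop :: "'a bop \<Rightarrow> 'a bop \<Rightarrow> 'a bop" is "(+)"
  by (simp add: blinfun.add_left scaleC_add_right)
lift_definition minus_bop :: "'a bop \<Rightarrow> 'a bop \<Rightarrow> 'a bop" is "(-)"
  by (simp add: blinfun.diff_left scaleC_diff_right)
lift_definition uminus_bop :: "'a bop \<Rightarrow> 'a bop" is uminus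
  by (simp add: blinfun.minus_left scaleC_minus_right)
lift_definition times_bop :: "'a bop \<Rightarrow> 'a bop \<Rightarrow> 'a bop" is "(o\<^sub>L)"
  by simp
lift_definition scaleR_bop :: "real \<Rightarrow> 'a bop \<Rightarrow> 'a bop" is "scaleR"
  by (simp add: blinfun.scaleR_left scaleC_scaleR_commute)
lift_definition scaleC_bop :: "complex \<Rightarrow> 'a bop \<Rightarrow> 'a bop"
  is "\<lambda>c T. Blinfun (\<lambda>x. c *\<^sub>C x) o\<^sub>L T"
  by (simp add: bounded_linear_Blinfun_apply bounded_linear_scaleC scaleC_scaleC mult.commute)

instance
  by standard
    (transfer, rule blinfun_eqI,
      simp add: blinfun.bilinear_simps bounded_linear_Blinfun_apply bounded_linear_scaleC
        scaleC_add_right scaleC_add_left scaleC_scaleC scaleR_scaleC algebra_simps)+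

end


section \<open>Operator order, square roots, inverses and the geometric mean\<close>

definition selfadjoint :: "'a::complex_inner bop \<Rightarrow> bool"
  where "selfadjoint T \<longleftrightarrow> (\<forall>x y. cinner (bop_apply T x) y = cinner x (bop_apply T y))"

text \<open>The values of the two quadratic forms are real, since both operators are self-adjoint.\<close>

definition op_le :: "'a::complex_inner bop \<Rightarrow> 'a bop \<Rightarrow> bool"  (infix \<open>\<preceq>\<close> 50)
  where "B \<preceq> A \<longleftrightarrow> selfadjoint B \<and> selfadjoint A \<and>
    (\<forall>x. Re (cinner (bop_apply B x) x) \<le> Re (cinner (bop_apply A x) x))"

definition positive_op :: "'a::complex_inner bop \<Rightarrow> bool"
  where "positive_op A \<longleftrightarrow> 0 \<preceq> A"

definition invertible_op :: "'a::complex_inner bop \<Rightarrow> bool"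
  where "invertible_op A \<longleftrightarrow> (\<exists>B. A * B = 1 \<and> B * A = 1)"

text \<open>As with \<open>inverse 0 = 0\<close> in fields, the inverse of a non-invertible operator is \<open>0\<close>.\<close>

definition op_inverse :: "'a::complex_inner bop \<Rightarrow> 'a bop"
  where "op_inverse A = (if invertible_op A then (THE B. A * B = 1 \<and> B * A = 1) else 0)"

text \<open>Meaningful for positive operators only.\<close>

definition op_sqrt :: "'a::complex_inner bop \<Rightarrow> 'a bop"
  where "op_sqrt A = (THE R. positive_op R \<and> R * R = A)"

definition op_inv_sqrt :: "'a::complex_inner bop \<Rightarrow> 'a bop"
  where "op_inv_sqrt A = op_inverse (op_sqrt A)"

text \<open>Meaningful for positive \<open>A\<close>, \<open>B\<close> with \<open>A\<close> invertible; for positive non-invertible \<open>A\<close> the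
  value is \<open>0\<close> by the convention for \<^const>\<open>op_inverse\<close>.\<close>

definition geometric_mean :: "'a::complex_inner bop \<Rightarrow> 'a bop \<Rightarrow> 'a bop"  (infixl \<open>\<sharp>\<close> 70)
  where "A \<sharp> B = op_sqrt A * op_sqrt (op_inv_sqrt A * B * op_inv_sqrt A) * op_sqrt A"

definition positive_linear_map ::
    "('a::complex_inner bop \<Rightarrow> 'b::complex_inner bop) \<Rightarrow> bool"
  where "positive_linear_map \<Phi> \<longleftrightarrow>
    (\<forall>X Y. \<Phi> (X + Y) = \<Phi> X + \<Phi> Y) \<and>
    (\<forall>c X. \<Phi> (c *\<^sub>C X) = c *\<^sub>C \<Phi> X) \<and>
    (\<forall>X. positive_op X \<longrightarrow> positive_op (\<Phi> X))"

end

theory Submission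
  imports Defs
begin

text \<open>Write \<open>A = a\<^sup>2\<close> and \<open>A \<sharp> B = a R a\<close> with \<open>R\<^sup>2 = a\<^sup>-\<^sup>1 B a\<^sup>-\<^sup>1\<close>. The hypothesis says \<open>m \<le> R \<le> M\<close>, and
  compressing \<open>(M - R) (R - m) \<ge> 0\<close> by \<open>a\<close> gives \<open>M m A + B \<le> (M + m) (A \<sharp> B)\<close>; applying \<open>\<Phi>\<close>
  is the Diaz--Metcalf inequality. Everything else follows from it by two forms of the
  arithmetic-geometric mean inequality, \<open>2 t (P \<sharp> Q) \<le> t\<^sup>2 P + Q\<close> and \<open>2 t \<le> X\<^sup>-\<^sup>1 + t\<^sup>2 X\<close> with
  \<open>t\<^sup>2 = M m\<close>; the second type reduces to the first with \<open>m = m\<^sub>2 / M\<^sub>1\<close> and \<open>M = M\<^sub>2 / m\<^sub>1\<close>.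

  Positive square roots come from the binomial series of \<open>(1 - Q)\<^bsup>1/2\<^esup>\<close>, which converges absolutely
  at \<open>\<parallel>Q\<parallel> \<le> 1\<close>, so no spectral theory is needed. Since \<open>\<Phi>\<close> is not assumed to be strictly positive,
  \<open>\<Phi> A\<close> may fail to be invertible; then \<open>\<Phi> (A \<sharp> B) \<le> k \<Phi> A\<close> fails to be invertible too and the
  conventions for inverses make the inequalities trivial.\<close>

section \<open>Self-adjoint operators and the operator order\<close>

lemma bop_eqI: "(\<And>x. bop_apply S x = bop_apply T x) \<Longrightarrow> S = T"
  unfolding bop_apply_def by (simp add: blinfun_of_bop_inject[symmetric] blinfun_eqI)

lemma bop_apply_simps [simp]:
  "bop_apply 0 x = 0"
  "bop_apply 1 x = x"
  "bop_apply (S + T) x = bop_apply S x + bop_apply T x"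
  "bop_apply (S - T) x = bop_apply S x - bop_apply T x"
  "bop_apply (- T) x = - bop_apply T x"
  "bop_apply (r *\<^sub>R T) x = r *\<^sub>R bop_apply T x"
  "bop_apply (S * T) x = bop_apply S (bop_apply T x)"
  "bop_apply T 0 = 0"
  "bop_apply T (x + y) = bop_apply T x + bop_apply T y"
  "bop_apply T (x - y) = bop_apply T x - bop_apply T y"
  "bop_apply T (r *\<^sub>R x) = r *\<^sub>R bop_apply T x"
  unfolding bop_apply_def
  by (simp_all add: zero_bop.rep_eq one_bop.rep_eq plus_bop.rep_eq minus_bop.rep_eq
      uminus_bop.rep_eq scaleR_bop.rep_eq times_bop.rep_eq blinfun.bilinear_simps)

lemma bop_apply_scaleC: "bop_apply T (c *\<^sub>C x) = c *\<^sub>C bop_apply T x"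
  using blinfun_of_bop[of T] by (simp add: bop_apply_def)

text \<open>Operators commute with multiplication by \<open>\<i>\<close>, and the imaginary part of
  \<open>cinner u v\<close> is minus the real inner product of \<open>\<i> *\<^sub>C u\<close> with
  \<open>v\<close>, so real symmetry already forces complex symmetry. From here on the real inner
  product suffices.\<close>

lemma selfadjoint_iff_inner:
  "selfadjoint T \<longleftrightarrow> (\<forall>x y. bop_apply T x \<bullet> y = x \<bullet> bop_apply T y)"
proof
  assume "selfadjoint T"
  then show "\<forall>x y. bop_apply T x \<bullet> y = x \<bullet> bop_apply T y"
    by (simp add: selfadjoint_def inner_eq_Re_cinner)
next
  assume R: "\<forall>x y. bop_apply T x \<bullet> y = x \<bullet> bop_apply T y"
  have Im: "Im (cinner u v) = - ((\<i> *\<^sub>C u) \<bullet> v)" for u v :: 'a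
    by (simp add: inner_eq_Re_cinner cinner_scaleC_left)
  show "selfadjoint T"
    unfolding selfadjoint_def
    using R by (simp add: complex_eq_iff Im flip: inner_eq_Re_cinner bop_apply_scaleC)
qed

lemma selfadjointD: "selfadjoint T \<Longrightarrow> bop_apply T x \<bullet> y = x \<bullet> bop_apply T y"
  by (simp add: selfadjoint_iff_inner)

lemma selfadjoint_0 [simp]: "selfadjoint 0"
  and selfadjoint_1 [simp]: "selfadjoint 1"
  and selfadjoint_add [simp]: "selfadjoint S \<Longrightarrow> selfadjoint T \<Longrightarrow> selfadjoint (S + T)"
  and selfadjoint_diff [simp]: "selfadjoint S \<Longrightarrow> selfadjoint T \<Longrightarrow> selfadjoint (S - T)"
  and selfadjoint_minus [simp]: "selfadjoint T \<Longrightarrow> selfadjoint (- T)"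
  and selfadjoint_scaleR [simp]: "selfadjoint T \<Longrightarrow> selfadjoint (r *\<^sub>R T)"
  by (simp_all add: selfadjoint_iff_inner inner_add inner_diff)

lemma selfadjoint_sandwich [simp]:
  "selfadjoint S \<Longrightarrow> selfadjoint T \<Longrightarrow> selfadjoint (S * T * S)"
  by (simp add: selfadjoint_iff_inner)

lemma op_le_iff:
  "S \<preceq> T \<longleftrightarrow>
    selfadjoint S \<and> selfadjoint T \<and> (\<forall>x. bop_apply S x \<bullet> x \<le> bop_apply T x \<bullet> x)"
  by (simp add: op_le_def inner_eq_Re_cinner)

lemma positive_op_iff:
  "positive_op T \<longleftrightarrow> selfadjoint T \<and> (\<forall>x. 0 \<le> bop_apply T x \<bullet> x)"
  by (simp add: positive_op_def op_le_iff)

lemma positive_op_selfadjoint [simp]: "positive_op T \<Longrightarrow> selfadjoint T"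
  by (simp add: positive_op_iff)

lemma op_le_iff_positive_diff:
  "S \<preceq> T \<longleftrightarrow> selfadjoint S \<and> selfadjoint T \<and> positive_op (T - S)"
  by (auto simp: op_le_iff positive_op_iff inner_diff)

lemma op_le_trans: "R \<preceq> S \<Longrightarrow> S \<preceq> T \<Longrightarrow> R \<preceq> T"
  unfolding op_le_iff by (meson order_trans)

lemma op_le_scaleR: "S \<preceq> T \<Longrightarrow> 0 \<le> r \<Longrightarrow> r *\<^sub>R S \<preceq> r *\<^sub>R T"
  by (auto simp: op_le_iff intro: mult_left_mono)

lemma op_le_scaleR_left: "positive_op T \<Longrightarrow> r \<le> s \<Longrightarrow> r *\<^sub>R T \<preceq> s *\<^sub>R T"
  by (auto simp: op_le_iff positive_op_iff intro: mult_right_mono)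

lemma op_le_sandwich: "S \<preceq> T \<Longrightarrow> selfadjoint R \<Longrightarrow> R * S * R \<preceq> R * T * R"
  unfolding op_le_iff by (simp add: selfadjointD[of R])

lemma positive_op_0 [simp]: "positive_op 0"
  and positive_op_1 [simp]: "positive_op 1"
  and positive_op_add [simp]: "positive_op S \<Longrightarrow> positive_op T \<Longrightarrow> positive_op (S + T)"
  and positive_op_scaleR [simp]: "positive_op T \<Longrightarrow> 0 \<le> r \<Longrightarrow> positive_op (r *\<^sub>R T)"
  by (auto simp: positive_op_iff inner_add)

lemma positive_op_sandwich [simp]:
  "positive_op T \<Longrightarrow> selfadjoint R \<Longrightarrow> positive_op (R * T * R)"
  using op_le_sandwich[of 0 T R] by (simp add: positive_op_def)

lemma positive_op_square [simp]: "selfadjoint R \<Longrightarrow> positive_op (R * R)"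
  using positive_op_sandwich[of 1 R] by simp

text \<open>With z = T x, the quadratic form at x - t z equals t^2 b - 2 t |z|^2, which is negative
  for small positive t unless z = 0.\<close>

lemma positive_op_quadratic_zero:
  assumes T: "positive_op T" and x: "bop_apply T x \<bullet> x = 0"
  shows "bop_apply T x = 0"
proof (rule ccontr)
  assume "bop_apply T x \<noteq> 0"
  define z where "z = bop_apply T x"
  define b where "b = bop_apply T z \<bullet> z"
  have z: "0 < z \<bullet> z" using \<open>bop_apply T x \<noteq> 0\<close> by (simp add: z_def)
  have b: "0 \<le> b" using T by (simp add: b_def positive_op_iff)
  have eq: "bop_apply T (x - t *\<^sub>R z) \<bullet> (x - t *\<^sub>R z) = t\<^sup>2 * b - 2 * t * (z \<bullet> z)" for t
    using x T
    by (simp add: inner_diff b_def z_def selfadjointD inner_commute power2_eq_square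
        algebra_simps)
  have nonneg: "0 \<le> t\<^sup>2 * b - 2 * t * (z \<bullet> z)" for t
    unfolding eq[symmetric] using T unfolding positive_op_iff by blast
  \<comment> \<open>The 1 in the denominator covers \<open>b = 0\<close>; \<open>t * b\<close> is
    then at most |z|^2, so the second factor in the next line is negative.\<close>
  define t where "t = (z \<bullet> z) / (b + 1)"
  have "0 \<le> t * (t * b - 2 * (z \<bullet> z))"
    using nonneg[of t] by (simp add: power2_eq_square algebra_simps)
  moreover have "0 < t" and "t * b \<le> z \<bullet> z"
    using b z by (simp_all add: t_def field_simps)
  ultimately show False
    using z by (simp add: zero_le_mult_iff)
qed

text \<open>For \<open>S + T = s\<close> the product \<open>S T\<close> equals \<open>(S T S + T S T) / s\<close>, so no square roots are
  needed to see that it is positive.\<close>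

lemma positive_op_mult_complementary:
  assumes "positive_op S" "positive_op T" "S + T = s *\<^sub>R 1" "0 < s"
  shows "positive_op (S * T)"
proof -
  have T: "T = s *\<^sub>R 1 - S" using assms(3) by (simp add: algebra_simps)
  have "S * T * S + T * S * T = s *\<^sub>R (S * T)"
    by (simp add: T algebra_simps)
  then have "S * T = (1 / s) *\<^sub>R (S * T * S + T * S * T)"
    using assms(4) by simp
  moreover have "positive_op ((1 / s) *\<^sub>R (S * T * S + T * S * T))"
    using assms by (intro positive_op_scaleR positive_op_add positive_op_sandwich) auto
  ultimately show ?thesis by simp
qed

lemma inner_le_of_norm_le:
  fixes x y :: "'a::real_inner"
  assumes "norm y \<le> c * norm x"
  shows "y \<bullet> x \<le> c * (x \<bullet> x)"
proof -
  have "y \<bullet> x \<le> norm y * norm x" by (rule norm_cauchy_schwarz)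
  also have "\<dots> \<le> c * norm x * norm x" by (rule mult_right_mono[OF assms norm_ge_zero])
  finally show ?thesis by (simp add: dot_square_norm power2_eq_square)
qed

text \<open>The form of \<open>R * R\<close> at x is |R x|^2, so the hypothesis is a norm bound on R
  x, and Cauchy-Schwarz turns it into a bound on the form of \<open>R\<close>.\<close>

lemma bop_le_of_square_le:
  assumes "positive_op R" and "R * R \<preceq> c\<^sup>2 *\<^sub>R 1" and "0 \<le> c"
  shows "R \<preceq> c *\<^sub>R 1"
  unfolding op_le_iff
proof (intro conjI allI)
  fix x
  have "bop_apply (R * R) x \<bullet> x \<le> c\<^sup>2 * (x \<bullet> x)"
    using assms(2) by (simp add: op_le_iff)
  then have "(norm (bop_apply R x))\<^sup>2 \<le> (c * norm x)\<^sup>2"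
    using selfadjointD[OF positive_op_selfadjoint[OF assms(1)], of "bop_apply R x" x]
    by (simp add: power_mult_distrib flip: dot_square_norm)
  then have "norm (bop_apply R x) \<le> c * norm x"
    by (rule power2_le_imp_le) (simp add: assms(3))
  then show "bop_apply R x \<bullet> x \<le> bop_apply (c *\<^sub>R 1) x \<bullet> x"
    by (simp add: inner_le_of_norm_le)
qed (use assms in auto)


section \<open>The Banach algebra of bounded operators\<close>

text \<open>The unital class \<open>real_normed_algebra_1\<close> would force
  \<open>norm 1 = 1\<close>, which fails on the zero space.\<close>

instantiation bop :: (complex_inner) real_normed_algebra
begin

lift_definition norm_bop :: "'a bop \<Rightarrow> real" is norm .

definition sgn_bop :: "'a bop \<Rightarrow> 'a bop"
  where "sgn_bop T = T /\<^sub>R norm T"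

definition dist_bop :: "'a bop \<Rightarrow> 'a bop \<Rightarrow> real"
  where "dist_bop S T = norm (S - T)"

definition uniformity_bop :: "('a bop \<times> 'a bop) filter"
  where [code del]: "uniformity_bop = (INF e\<in>{0 <..}. principal {(S, T). dist S T < e})"

definition open_bop :: "'a bop set \<Rightarrow> bool"
  where [code del]: "open_bop U = (\<forall>S\<in>U. \<forall>\<^sub>F (S', T) in uniformity. S' = S \<longrightarrow> T \<in> U)"

instance
proof
  fix S T :: "'a bop" and r :: real
  show "norm T = 0 \<longleftrightarrow> T = 0"
    unfolding norm_bop.rep_eq norm_eq_zero blinfun_of_bop_inject[symmetric] zero_bop.rep_eq ..
  show "norm (S + T) \<le> norm S + norm T"
    unfolding norm_bop.rep_eq plus_bop.rep_eq by (rule norm_triangle_ineq)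
  show "norm (r *\<^sub>R T) = \<bar>r\<bar> * norm T"
    unfolding norm_bop.rep_eq scaleR_bop.rep_eq by (rule norm_scaleR)
  show "norm (S * T) \<le> norm S * norm T"
    unfolding norm_bop.rep_eq times_bop.rep_eq by (rule norm_blinfun_compose)
  show "sgn T = T /\<^sub>R norm T" by (rule sgn_bop_def)
  show "dist S T = norm (S - T)" by (rule dist_bop_def)
  show "uniformity = (INF e\<in>{0 <..}. principal {(S :: 'a bop, T). dist S T < e})"
    by (rule uniformity_bop_def)
  show "open U = (\<forall>S\<in>U. \<forall>\<^sub>F (S', T) in uniformity. S' = S \<longrightarrow> T \<in> U)" for U :: "'a bop set"
    by (rule open_bop_def)
qed

end

instance chilbert_space \<subseteq> banach ..

text \<open>The limit exists among bounded real-linear maps. It is complex-linear because it is also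
  a pointwise limit and scalar multiplication is continuous.\<close>

instance bop :: (chilbert_space) banach
proof
  fix X :: "nat \<Rightarrow> 'a bop"
  assume X: "Cauchy X"
  have dist: "dist S T = dist (blinfun_of_bop S) (blinfun_of_bop T)" for S T :: "'a bop"
    by (simp add: dist_norm norm_bop.rep_eq minus_bop.rep_eq)
  have "Cauchy (\<lambda>n. blinfun_of_bop (X n))"
    using X by (simp add: Cauchy_def dist)
  then obtain L where L: "(\<lambda>n. blinfun_of_bop (X n)) \<longlonglongrightarrow> L"
    using Cauchy_convergent_iff convergent_def by blast
  have lim: "(\<lambda>n. bop_apply (X n) x) \<longlonglongrightarrow> L x" for x
    unfolding bop_apply_def by (intro tendsto_intros L)
  have "L (c *\<^sub>C x) = c *\<^sub>C L x" for c x
  proof (rule LIMSEQ_unique)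
    show "(\<lambda>n. bop_apply (X n) (c *\<^sub>C x)) \<longlonglongrightarrow> L (c *\<^sub>C x)" by (rule lim)
    show "(\<lambda>n. bop_apply (X n) (c *\<^sub>C x)) \<longlonglongrightarrow> c *\<^sub>C L x"
      unfolding bop_apply_scaleC
      by (rule bounded_linear.tendsto[OF bounded_linear_scaleC lim])
  qed
  then have "blinfun_of_bop (Abs_bop L) = L" by (simp add: Abs_bop_inverse)
  then have "X \<longlonglongrightarrow> Abs_bop L"
    using L by (simp add: tendsto_iff dist)
  then show "convergent X" by (auto simp: convergent_def)
qed

lemma norm_bop_apply: "norm (bop_apply T x) \<le> norm T * norm x"
  unfolding bop_apply_def norm_bop.rep_eq by (rule norm_blinfun)

lemma norm_bop_bound:
  "0 \<le> b \<Longrightarrow> (\<And>x. norm (bop_apply T x) \<le> b * norm x) \<Longrightarrow> norm T \<le> b"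
  unfolding bop_apply_def norm_bop.rep_eq by (rule norm_blinfun_bound)

lemma bounded_linear_bop_apply: "bounded_linear (\<lambda>T. bop_apply T x)"
  by (rule bounded_linear_intro[where K = "norm x"]) (simp_all add: norm_bop_apply)

lemma bop_le_norm: "selfadjoint T \<Longrightarrow> T \<preceq> norm T *\<^sub>R 1"
  by (simp add: op_le_iff inner_le_of_norm_le norm_bop_apply)

text \<open>Positivity of Q (1 - Q) says that |Q x|^2 is at most the form of Q at x, which is at
  most |x|^2.\<close>

lemma norm_contraction_le_1:
  assumes Q: "positive_op Q" and Q1: "Q \<preceq> 1"
  shows "norm Q \<le> 1"
proof (rule norm_bop_bound)
  fix x
  have "positive_op (Q * (1 - Q))"
    by (rule positive_op_mult_complementary[where s = 1])
      (use Q Q1 op_le_iff_positive_diff[of Q 1] in simp_all)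
  then have "bop_apply Q x \<bullet> bop_apply Q x \<le> bop_apply Q x \<bullet> x"
    using selfadjointD[OF positive_op_selfadjoint[OF Q]]
    by (simp add: positive_op_iff inner_diff)
  also have "\<dots> \<le> x \<bullet> x" using Q1 by (simp add: op_le_iff)
  finally show "norm (bop_apply Q x) \<le> 1 * norm x"
    by (simp add: norm_eq_sqrt_inner)
qed simp


section \<open>Power series and the positive square root\<close>

lemma selfadjoint_mult_commuting:
  assumes "selfadjoint S" "selfadjoint T" and comm: "S * T = T * S"
  shows "selfadjoint (S * T)"
  unfolding selfadjoint_iff_inner
proof (intro allI)
  fix x y
  have "bop_apply (S * T) x \<bullet> y = x \<bullet> bop_apply (T * S) y"
    by (simp add: selfadjointD[OF assms(1)] selfadjointD[OF assms(2)])
  then show "bop_apply (S * T) x \<bullet> y = x \<bullet> bop_apply (S * T) y"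
    by (simp only: comm)
qed

lemma selfadjoint_power [simp]: "selfadjoint Q \<Longrightarrow> selfadjoint (Q ^ n)"
  by (induction n) (simp_all add: selfadjoint_mult_commuting power_commutes)

lemma norm_bop_power_le_1:
  fixes Q :: "'a::complex_inner bop"
  assumes "norm Q \<le> 1"
  shows "norm (Q ^ n) \<le> 1"
proof (induction n)
  case 0
  show ?case by (rule norm_bop_bound) simp_all
next
  case (Suc n)
  then show ?case
    using norm_mult_ineq[of Q "Q ^ n"] mult_mono[of "norm Q" 1 "norm (Q ^ n)" 1] assms by simp
qed

definition bop_series :: "(nat \<Rightarrow> real) \<Rightarrow> 'a::complex_inner bop \<Rightarrow> 'a bop"
  where "bop_series a Q = (\<Sum>n. a n *\<^sub>R Q ^ n)"

lemma summable_norm_bop_series: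
  fixes Q :: "'a::complex_inner bop"
  assumes "norm Q \<le> 1" "summable (\<lambda>n. \<bar>a n\<bar>)"
  shows "summable (\<lambda>n. norm (a n *\<^sub>R Q ^ n))"
  by (rule summable_comparison_test'[OF assms(2), of 0])
    (simp add: mult_left_le norm_bop_power_le_1 assms(1))

lemma summable_bop_series:
  fixes Q :: "'a::chilbert_space bop"
  assumes "norm Q \<le> 1" "summable (\<lambda>n. \<bar>a n\<bar>)"
  shows "summable (\<lambda>n. a n *\<^sub>R Q ^ n)"
  by (rule summable_norm_cancel) (rule summable_norm_bop_series[OF assms])

lemma bop_series_mult:
  fixes Q :: "'a::chilbert_space bop"
  assumes "norm Q \<le> 1" "summable (\<lambda>n. \<bar>a n\<bar>)" "summable (\<lambda>n. \<bar>b n\<bar>)"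
  shows "bop_series a Q * bop_series b Q = bop_series (\<lambda>n. \<Sum>i\<le>n. a i * b (n - i)) Q"
proof -
  have "bop_series a Q * bop_series b Q =
      (\<Sum>n. \<Sum>i\<le>n. (a i *\<^sub>R Q ^ i) * (b (n - i) *\<^sub>R Q ^ (n - i)))"
    unfolding bop_series_def
    by (intro Cauchy_product summable_norm_bop_series assms)
  also have "\<dots> = bop_series (\<lambda>n. \<Sum>i\<le>n. a i * b (n - i)) Q"
    unfolding bop_series_def scaleR_sum_left
    by (intro suminf_cong sum.cong) (simp_all flip: power_add)
  finally show ?thesis .
qed

text \<open>This is what later lets any positive square root be compared with the one built as a
  series.\<close>

lemma bop_series_commute:
  fixes Q T :: "'a::chilbert_space bop"
  assumes "norm Q \<le> 1" "summable (\<lambda>n. \<bar>a n\<bar>)" and TQ: "T * Q = Q * T"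
  shows "T * bop_series a Q = bop_series a Q * T"
proof -
  have pow: "T * Q ^ n = Q ^ n * T" for n
  proof (induction n)
    case (Suc n)
    have "T * Q ^ Suc n = Q * (T * Q ^ n)"
      by (simp add: TQ flip: mult.assoc)
    then show ?case by (simp add: Suc mult.assoc)
  qed simp
  show ?thesis
    unfolding bop_series_def
    by (simp add: pow suminf_mult[symmetric] suminf_mult2 summable_bop_series assms(1,2))
qed

lemma inner_bop_series:
  fixes Q :: "'a::chilbert_space bop"
  assumes "norm Q \<le> 1" "summable (\<lambda>n. \<bar>a n\<bar>)"
  shows "(\<lambda>n. a n * (bop_apply (Q ^ n) x \<bullet> y)) sums (bop_apply (bop_series a Q) x \<bullet> y)"
proof -
  have "bounded_linear (\<lambda>T. bop_apply T x \<bullet> y)"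
    by (rule bounded_linear_compose[OF bounded_linear_inner_left bounded_linear_bop_apply])
  from bounded_linear.sums[OF this summable_sums[OF summable_bop_series[OF assms]]]
  show ?thesis by (simp add: bop_series_def)
qed

lemma selfadjoint_bop_series:
  fixes Q :: "'a::chilbert_space bop"
  assumes "norm Q \<le> 1" "summable (\<lambda>n. \<bar>a n\<bar>)" and Q: "selfadjoint Q"
  shows "selfadjoint (bop_series a Q)"
  unfolding selfadjoint_iff_inner
proof (intro allI)
  fix x y
  have "bop_apply (Q ^ n) y \<bullet> x = bop_apply (Q ^ n) x \<bullet> y" for n
    using selfadjointD[OF selfadjoint_power[OF Q], of n y x] by (simp only: inner_commute)
  then have "bop_apply (bop_series a Q) y \<bullet> x = bop_apply (bop_series a Q) x \<bullet> y"
    using inner_bop_series[OF assms(1,2), of y x] inner_bop_series[OF assms(1,2), of x y]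
    by (auto intro: sums_unique2)
  then show "bop_apply (bop_series a Q) x \<bullet> y = x \<bullet> bop_apply (bop_series a Q) y"
    by (simp add: inner_commute)
qed

section \<open>Taylor coefficients of the function sqrt (1 - x)\<close>

definition sqrt_coeff :: "nat \<Rightarrow> real"
  where "sqrt_coeff n = (-1) ^ n * (1 / 2 gchoose n)"

lemma sqrt_coeff_0 [simp]: "sqrt_coeff 0 = 1"
  by (simp add: sqrt_coeff_def)

text \<open>The coefficient is \<open>pochhammer (-1/2) n / fact n\<close>; its first factor is -1/2
  and all later ones are positive.\<close>

lemma sqrt_coeff_neg: "0 < n \<Longrightarrow> sqrt_coeff n \<le> 0"
  by (cases n)
    (auto simp: sqrt_coeff_def gbinomial_pochhammer pochhammer_rec divide_nonneg_pos
      pochhammer_nonneg)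

text \<open>Dividing a power series by 1 - x replaces coefficients by partial sums, so this sum is
  the n-th coefficient of (1 - x)^(-1/2), which is nonnegative.\<close>

lemma sum_sqrt_coeff_nonneg: "0 \<le> sum sqrt_coeff {..n}"
proof -
  have "sum sqrt_coeff {..n} = (-1) ^ n * (-1 / 2 gchoose n)"
    using gbinomial_sum_lower_neg[of "1 / 2 :: real" n]
    by (simp add: sqrt_coeff_def mult.commute)
  also have "\<dots> = pochhammer (1 / 2) n / fact n"
    by (simp add: gbinomial_pochhammer)
  also have "\<dots> \<ge> 0" by (simp add: pochhammer_nonneg)
  finally show ?thesis .
qed

text \<open>Only the coefficient 1 at index 0 is positive, so the sum of absolute values is 2 minus
  the partial sum, hence at most 2.\<close>

lemma summable_abs_sqrt_coeff: "summable (\<lambda>n. \<bar>sqrt_coeff n\<bar>)"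
proof (rule bounded_imp_summable)
  fix n
  have "(\<Sum>k\<le>n. \<bar>sqrt_coeff k\<bar>) = (\<Sum>k\<le>n. (if k = 0 then 2 else 0) - sqrt_coeff k)"
    by (intro sum.cong) (auto simp: sqrt_coeff_neg abs_of_nonpos)
  also have "\<dots> \<le> 2"
    using sum_sqrt_coeff_nonneg[of n] by (simp add: sum_subtractf)
  finally show "(\<Sum>k\<le>n. \<bar>sqrt_coeff k\<bar>) \<le> 2" .
qed simp

lemma suminf_sqrt_coeff_nonneg: "0 \<le> suminf sqrt_coeff"
  using sum_sqrt_coeff_nonneg summable_LIMSEQ'[OF summable_rabs_cancel[OF summable_abs_sqrt_coeff]]
  by (intro LIMSEQ_le_const) auto

text \<open>The square of the series is 1 - x: this is Vandermonde's identity for 1/2 + 1/2 = 1,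
  read off coefficientwise.\<close>

lemma sqrt_coeff_convolution:
  "(\<Sum>i\<le>n. sqrt_coeff i * sqrt_coeff (n - i)) = (-1) ^ n * real (1 choose n)"
proof -
  have "(\<Sum>i\<le>n. sqrt_coeff i * sqrt_coeff (n - i)) =
      (\<Sum>i\<le>n. (-1) ^ n * ((1 / 2 gchoose i) * (1 / 2 gchoose (n - i))))"
    by (intro sum.cong) (auto simp: sqrt_coeff_def simp flip: power_add)
  also have "\<dots> = (-1) ^ n * (1 gchoose n)"
    using gbinomial_Vandermonde[of "1 / 2 :: real" "1 / 2" n]
    by (simp add: sum_distrib_left[symmetric] atLeast0AtMost)
  finally show ?thesis by (simp add: binomial_gbinomial)
qed

section \<open>Existence and uniqueness of the positive square root\<close>

lemma ex_sqrt_contraction: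
  fixes Q :: "'a::chilbert_space bop"
  assumes Q: "positive_op Q" and Q1: "Q \<preceq> 1"
  shows "\<exists>S. positive_op S \<and> S * S = 1 - Q \<and> (\<forall>T. T * Q = Q * T \<longrightarrow> T * S = S * T)"
proof (intro exI conjI allI impI)
  let ?S = "bop_series sqrt_coeff Q"
  note n1 = norm_contraction_le_1[OF Q Q1] and sum = summable_abs_sqrt_coeff
  have "0 \<le> bop_apply ?S x \<bullet> x" for x
  proof -
    \<comment> \<open>For positive n the coefficient is nonpositive and the form of Q^n at x is at
      most |x|^2. Summing, the form of the series is at least |x|^2 times the sum of all
      coefficients, which is nonnegative.\<close>
    have "sqrt_coeff n * (x \<bullet> x) \<le> sqrt_coeff n * (bop_apply (Q ^ n) x \<bullet> x)" for n
    proof (cases "n = 0")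
      case False
      have "bop_apply (Q ^ n) x \<bullet> x \<le> norm (Q ^ n) * (x \<bullet> x)"
        using bop_le_norm[of "Q ^ n"] Q by (simp add: op_le_iff)
      also have "\<dots> \<le> x \<bullet> x"
        using norm_bop_power_le_1[OF n1, of n] by (simp add: mult_left_le_one_le)
      finally show ?thesis
        using sqrt_coeff_neg[of n] False by (intro mult_left_mono_neg) auto
    qed simp
    moreover have "(\<lambda>n. sqrt_coeff n * (x \<bullet> x)) sums (suminf sqrt_coeff * (x \<bullet> x))"
      by (rule sums_mult2[OF summable_sums[OF summable_rabs_cancel[OF sum]]])
    ultimately have "suminf sqrt_coeff * (x \<bullet> x) \<le> bop_apply ?S x \<bullet> x"
      using inner_bop_series[OF n1 sum, of x x] by (rule sums_le)
    then show ?thesis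
      using suminf_sqrt_coeff_nonneg by (meson inner_ge_zero mult_nonneg_nonneg order_trans)
  qed
  then show "positive_op ?S"
    using Q by (simp add: positive_op_iff selfadjoint_bop_series n1 sum)
  have "?S * ?S = bop_series (\<lambda>n. (-1) ^ n * real (1 choose n)) Q"
    by (simp add: bop_series_mult n1 sum sqrt_coeff_convolution)
  also have "\<dots> = (\<Sum>n\<in>{0, 1}. ((-1) ^ n * real (1 choose n)) *\<^sub>R Q ^ n)"
    unfolding bop_series_def by (intro suminf_finite) (auto simp: binomial_eq_0)
  finally show "?S * ?S = 1 - Q" by simp
  show "T * ?S = ?S * T" if "T * Q = Q * T" for T
    using that by (rule bop_series_commute[OF n1 sum])
qed

text \<open>Rescaling writes P as c (1 - Q) with Q between 0 and 1; the added 1 keeps c positive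
  when P = 0. The commutation clause serves the uniqueness proof.\<close>

lemma ex_positive_sqrt:
  fixes P :: "'a::chilbert_space bop"
  assumes P: "positive_op P"
  shows "\<exists>S. positive_op S \<and> S * S = P \<and> (\<forall>T. T * P = P * T \<longrightarrow> T * S = S * T)"
proof -
  define c where "c = norm P + 1"
  have c: "0 < c" by (simp add: c_def add_nonneg_pos)
  define Q where "Q = 1 - (1 / c) *\<^sub>R P"
  have PQ: "P = c *\<^sub>R (1 - Q)" using c by (simp add: Q_def)
  have "P \<preceq> c *\<^sub>R 1"
    by (rule op_le_trans[OF bop_le_norm op_le_scaleR_left]) (use P in \<open>auto simp: c_def\<close>)
  then have "(1 / c) *\<^sub>R P \<preceq> (1 / c) *\<^sub>R c *\<^sub>R 1"
    using c by (intro op_le_scaleR) auto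
  then have "positive_op Q"
    using c by (simp add: Q_def op_le_iff_positive_diff)
  moreover have "Q \<preceq> 1"
    using P c by (simp add: Q_def op_le_iff_positive_diff)
  ultimately obtain S where S: "positive_op S" "S * S = 1 - Q"
      "\<And>T. T * Q = Q * T \<Longrightarrow> T * S = S * T"
    using ex_sqrt_contraction by blast
  show ?thesis
  proof (intro exI conjI allI impI)
    show "positive_op (sqrt c *\<^sub>R S)" using S(1) c by simp
    show "(sqrt c *\<^sub>R S) * (sqrt c *\<^sub>R S) = P" using S(2) c by (simp add: PQ)
    fix T assume "T * P = P * T"
    then have "T * Q = Q * T" by (simp add: Q_def algebra_simps)
    then show "T * (sqrt c *\<^sub>R S) = (sqrt c *\<^sub>R S) * T" using S(3)[of T] by simp
  qed
qed

text \<open>By commutation (S + R)(S - R) = 0. For y = (S - R) x the nonnegative forms of S and R at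
  y therefore add up to 0, so S y = R y = 0, and |y|^2 is the inner product of (S - R) y with
  x.\<close>

lemma positive_sqrt_unique_commuting:
  assumes R: "positive_op R" and S: "positive_op S" and eq: "R * R = S * S"
    and comm: "R * S = S * R"
  shows "R = S"
proof (rule bop_eqI)
  fix x
  define y where "y = bop_apply (S - R) x"
  have "(S + R) * (S - R) = 0" using eq comm by (simp add: algebra_simps)
  then have "bop_apply (S + R) y = 0"
    by (metis bop_apply_simps(1,7) y_def)
  then have "bop_apply S y \<bullet> y + bop_apply R y \<bullet> y = 0"
    by (simp flip: inner_add_left)
  moreover have "0 \<le> bop_apply S y \<bullet> y" "0 \<le> bop_apply R y \<bullet> y"
    using R S by (simp_all add: positive_op_iff)
  ultimately have "bop_apply S y = 0" "bop_apply R y = 0"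
    using R S by (auto intro!: positive_op_quadratic_zero)
  then have "bop_apply (S - R) y = 0" by simp
  moreover have "y \<bullet> y = bop_apply (S - R) y \<bullet> x"
    using R S selfadjointD[of "S - R" y x] by (simp add: y_def)
  ultimately have "y = 0" by simp
  then show "bop_apply R x = bop_apply S x" by (simp add: y_def)
qed

text \<open>Any root T of P commutes with P = T T, hence with the constructed root S, so the
  commuting case gives T = S and the description in \<open>op_sqrt\<close> denotes.\<close>

lemma op_sqrt_eqI:
  fixes R :: "'a::chilbert_space bop"
  assumes R: "positive_op R" and P: "R * R = P"
  shows "op_sqrt P = R"
proof -
  have "positive_op P" using R P by auto
  from ex_positive_sqrt[OF this]
  obtain S where S: "positive_op S" "S * S = P" "\<And>T. T * P = P * T \<Longrightarrow> T * S = S * T"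
    by blast
  have "T = S" if T: "positive_op T" "T * T = P" for T
  proof (rule positive_sqrt_unique_commuting)
    show "T * T = S * S" by (simp only: T S)
    have "T * P = P * T" unfolding T(2)[symmetric] by (rule mult.assoc[symmetric])
    then show "T * S = S * T" by (rule S(3))
  qed (fact T S)+
  then show ?thesis
    unfolding op_sqrt_def using R P by (intro the_equality) auto
qed

lemma
  fixes P :: "'a::chilbert_space bop"
  assumes "positive_op P"
  shows positive_op_sqrt [simp]: "positive_op (op_sqrt P)"
    and op_sqrt_mult_self [simp]: "op_sqrt P * op_sqrt P = P"
proof -
  from ex_positive_sqrt[OF assms] obtain S where S: "positive_op S" "S * S = P"
    by blast
  moreover have "op_sqrt P = S" by (rule op_sqrt_eqI[OF S])
  ultimately show "positive_op (op_sqrt P)" "op_sqrt P * op_sqrt P = P"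
    by simp_all
qed


section \<open>Inverses\<close>

lemma invertible_opI: "A * B = 1 \<Longrightarrow> B * A = 1 \<Longrightarrow> invertible_op A"
  unfolding invertible_op_def by blast

lemma left_inverse_eq_right_inverse:
  fixes x :: "'a::monoid_mult"
  assumes "y * x = 1" "x * z = 1"
  shows "y = z"
  using assms mult.assoc[of y x z] by simp

lemma op_inverse_eqI:
  assumes "A * B = 1" "B * A = 1"
  shows "op_inverse A = B"
proof -
  have "(THE B. A * B = 1 \<and> B * A = 1) = B"
    using assms by (intro the_equality) (auto intro: left_inverse_eq_right_inverse)
  then show ?thesis
    using invertible_opI[OF assms] by (simp add: op_inverse_def)
qed

lemma
  assumes "invertible_op A"
  shows op_inverse_right [simp]: "A * op_inverse A = 1"
    and op_inverse_left [simp]: "op_inverse A * A = 1"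
proof -
  from assms obtain B where "A * B = 1" "B * A = 1"
    by (auto simp: invertible_op_def)
  moreover from this have "op_inverse A = B" by (rule op_inverse_eqI)
  ultimately show "A * op_inverse A = 1" "op_inverse A * A = 1" by simp_all
qed

lemma op_inverse_right_assoc [simp]: "invertible_op A \<Longrightarrow> A * (op_inverse A * X) = X"
  and op_inverse_left_assoc [simp]: "invertible_op A \<Longrightarrow> op_inverse A * (A * X) = X"
  by (simp_all flip: mult.assoc)

lemma invertible_op_inverse: "invertible_op A \<Longrightarrow> invertible_op (op_inverse A)"
  by (rule invertible_opI[where B = A]) simp_all

lemma op_inverse_op_inverse: "invertible_op A \<Longrightarrow> op_inverse (op_inverse A) = A"
  by (rule op_inverse_eqI) simp_all

lemma selfadjoint_op_inverse:
  assumes "selfadjoint A" "invertible_op A"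
  shows "selfadjoint (op_inverse A)"
  unfolding selfadjoint_iff_inner
proof (intro allI)
  fix x y
  define u where "u = bop_apply (op_inverse A) x"
  define v where "v = bop_apply (op_inverse A) y"
  have "bop_apply A (bop_apply (op_inverse A) z) = z" for z
    using assms(2) by (simp flip: bop_apply_simps(7))
  then have "x = bop_apply A u" "y = bop_apply A v" by (simp_all add: u_def v_def)
  then have "u \<bullet> y = x \<bullet> v" using selfadjointD[OF assms(1), of u v] by simp
  then show "bop_apply (op_inverse A) x \<bullet> y = x \<bullet> bop_apply (op_inverse A) y"
    by (simp only: u_def v_def)
qed

text \<open>The inverse N equals N A N, a congruence of A; without invertibility the default value 0
  is positive as well.\<close>

lemma positive_op_inverse [simp]:
  assumes "positive_op A"
  shows "positive_op (op_inverse A)"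
proof (cases "invertible_op A")
  case True
  have "positive_op (op_inverse A * A * op_inverse A)"
    using assms True by (intro positive_op_sandwich selfadjoint_op_inverse) simp_all
  then show ?thesis using True by simp
qed (simp add: op_inverse_def)

lemma invertible_op_mult:
  assumes "invertible_op A" "invertible_op B"
  shows "invertible_op (A * B)"
  by (rule invertible_opI[where B = "op_inverse B * op_inverse A"])
    (simp_all add: mult.assoc assms)

lemma op_inverse_square:
  assumes "a * n = 1" "n * a = 1"
  shows "op_inverse (a * a) = n * n"
proof (rule op_inverse_eqI)
  have "a * a * (n * n) = a * (a * n) * n" "n * n * (a * a) = n * (n * a) * a"
    by (simp_all only: mult.assoc)
  then show "a * a * (n * n) = 1" "n * n * (a * a) = 1" by (simp_all add: assms)
qed

text \<open>Multiplying the inverse of \<open>R * R\<close> by \<open>R\<close> on either side gives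
  a right and a left inverse of \<open>R\<close>, which must coincide.\<close>

lemma invertible_op_of_square:
  assumes "invertible_op (R * R)"
  shows "invertible_op R"
proof -
  have right: "R * (R * op_inverse (R * R)) = 1" and left: "(op_inverse (R * R) * R) * R = 1"
    using op_inverse_right[OF assms] op_inverse_left[OF assms] by (simp_all only: mult.assoc)
  show ?thesis
    using right left unfolding left_inverse_eq_right_inverse[OF left right]
    by (rule invertible_opI)
qed

lemma invertible_op_scaleR:
  assumes "invertible_op A" "r \<noteq> 0"
  shows "invertible_op (r *\<^sub>R A)"
  by (rule invertible_opI[where B = "(1 / r) *\<^sub>R op_inverse A"]) (simp_all add: assms)

text \<open>Neumann series, rescaled so that it is a power series at a contraction.\<close>

lemma invertible_op_bounded_below:
  fixes D :: "'a::chilbert_space bop"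
  assumes D: "d *\<^sub>R 1 \<preceq> D" and d: "0 < d"
  shows "invertible_op D"
proof -
  have sa: "selfadjoint D" using D by (simp add: op_le_iff)
  \<comment> \<open>The summand \<open>d + 1\<close> makes c exceed d, so that q is positive; on the
    zero space \<open>norm D\<close> alone would be smaller than d.\<close>
  define c where "c = norm D + d + 1"
  have c: "0 < c" "d < c" using d by (simp_all add: c_def add_nonneg_pos add_pos_pos)
  define q where "q = 1 - d / c"
  have q: "0 < q" "q < 1" using c d by (simp_all add: q_def)
  \<comment> \<open>From d <= D <= c follows 0 <= 1 - D/c <= q, so Q lies between 0 and 1. Up to the
    factor c, D is inverted by the series with coefficients q^n, absolutely summable even if Q has
    norm 1.\<close>
  define Q where "Q = (1 / q) *\<^sub>R (1 - (1 / c) *\<^sub>R D)"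
  have DQ: "D = c *\<^sub>R (1 - q *\<^sub>R Q)" using c q by (simp add: Q_def algebra_simps)
  have Q0: "positive_op Q"
  proof -
    have "D \<preceq> c *\<^sub>R 1"
      by (rule op_le_trans[OF bop_le_norm[OF sa] op_le_scaleR_left]) (use d in \<open>auto simp: c_def\<close>)
    then have "positive_op ((1 / (q * c)) *\<^sub>R (c *\<^sub>R 1 - D))"
      using c q by (intro positive_op_scaleR) (auto simp: op_le_iff_positive_diff)
    also have "(1 / (q * c)) *\<^sub>R (c *\<^sub>R 1 - D) = Q"
      using c q by (simp add: Q_def scaleR_diff_right)
    finally show ?thesis .
  qed
  have "positive_op ((1 / (q * c)) *\<^sub>R (D - d *\<^sub>R 1))"
    using c q D by (intro positive_op_scaleR) (auto simp: op_le_iff_positive_diff)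
  also have "(1 / (q * c)) *\<^sub>R (D - d *\<^sub>R 1) = 1 - Q"
  proof -
    have "1 - (1 / q) * (1 - d / c) = 0" using q by (simp add: q_def[symmetric])
    then have "1 - Q = (1 / (q * c)) *\<^sub>R D + (1 - 1 / q) *\<^sub>R 1"
      by (simp add: Q_def algebra_simps)
    also have "1 - 1 / q = - (1 / (q * c) * d)"
      using c q by (simp add: q_def field_simps)
    finally show ?thesis by (simp add: algebra_simps)
  qed
  finally have "Q \<preceq> 1" using Q0 by (simp add: op_le_iff_positive_diff)
  note n1 = norm_contraction_le_1[OF Q0 this]
  define b where "b n = (if n = 0 then 1 else if n = 1 then - q else 0)" for n :: nat
  have b_series: "bop_series b Q = 1 - q *\<^sub>R Q"
  proof -
    have "bop_series b Q = (\<Sum>n\<in>{0, 1}. b n *\<^sub>R Q ^ n)"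
      unfolding bop_series_def by (intro suminf_finite) (auto simp: b_def)
    then show ?thesis by (simp add: b_def)
  qed
  have sb: "summable (\<lambda>n. \<bar>b n\<bar>)"
    by (rule summable_finite[of "{0, 1}"]) (auto simp: b_def)
  have sq: "summable (\<lambda>n. \<bar>q ^ n\<bar>)"
    using q by (simp add: summable_geometric)
  have conv: "(\<Sum>i\<le>n. q ^ i * b (n - i)) = (if n = 0 then 1 else 0)" for n
  proof (cases n)
    case (Suc k)
    \<comment> \<open>Only the last two products survive, and q^k (-q) cancels q^(k+1).\<close>
    have "(\<Sum>i\<le>n. q ^ i * b (n - i)) = (\<Sum>i\<in>{k, Suc k}. q ^ i * b (n - i))"
      by (intro sum.mono_neutral_right) (auto simp: Suc b_def)
    then show ?thesis by (simp add: Suc b_def)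
  qed (simp add: b_def)
  define N where "N = bop_series (\<lambda>n. q ^ n) Q"
  have "N * bop_series b Q = bop_series (\<lambda>n. if n = 0 then 1 else 0) Q"
    unfolding N_def by (simp add: bop_series_mult n1 sb sq conv)
  also have "\<dots> = (\<Sum>n\<in>{0}. (if n = 0 then 1 else 0) *\<^sub>R Q ^ n)"
    unfolding bop_series_def by (intro suminf_finite) auto
  finally have left: "N * (1 - q *\<^sub>R Q) = 1" by (simp add: b_series)
  moreover have "(1 - q *\<^sub>R Q) * N = N * (1 - q *\<^sub>R Q)"
    unfolding N_def by (rule bop_series_commute[OF n1 sq]) (simp add: algebra_simps)
  ultimately have "invertible_op (1 - q *\<^sub>R Q)"
    by (intro invertible_opI[where B = N]) simp_all
  then show ?thesis
    unfolding DQ using c by (intro invertible_op_scaleR) auto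
qed

section \<open>Scalar bounds under inversion and square roots\<close>

lemma op_inverse_amgm:
  assumes R: "positive_op R" and N: "positive_op N" and RN: "R * N = 1" "N * R = 1"
  shows "(2 * t) *\<^sub>R 1 \<preceq> N + t\<^sup>2 *\<^sub>R R"
proof -
  have "(1 - t *\<^sub>R R) * N * (1 - t *\<^sub>R R) = N + t\<^sup>2 *\<^sub>R R - (2 * t) *\<^sub>R 1"
    by (simp add: algebra_simps RN power2_eq_square flip: scaleR_2)
  moreover have "positive_op ((1 - t *\<^sub>R R) * N * (1 - t *\<^sub>R R))"
    using R N by (intro positive_op_sandwich) simp_all
  ultimately show ?thesis
    using R N by (simp add: op_le_iff_positive_diff)
qed

text \<open>Take t = 1/c in \<open>op_inverse_amgm\<close>, the tangent to 1/r at r = c: 2/c is at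
  most N + R/c^2, and R/c^2 is at most 1/c.\<close>

lemma op_inverse_bounded_below:
  assumes R: "positive_op R" and inv: "invertible_op R" and le: "R \<preceq> c *\<^sub>R 1" and c: "0 < c"
  shows "(1 / c) *\<^sub>R 1 \<preceq> op_inverse R"
proof -
  define N where "N = op_inverse R"
  have N: "positive_op N" using R by (simp add: N_def)
  have "(2 * (1 / c)) *\<^sub>R 1 \<preceq> N + (1 / c)\<^sup>2 *\<^sub>R R"
    using R inv N unfolding N_def by (intro op_inverse_amgm) simp_all
  then have 1: "positive_op (N + (1 / c)\<^sup>2 *\<^sub>R R - (2 / c) *\<^sub>R 1)"
    by (simp add: op_le_iff_positive_diff)
  have 2: "positive_op ((1 / c)\<^sup>2 *\<^sub>R (c *\<^sub>R 1 - R))"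
    using le by (intro positive_op_scaleR) (auto simp: op_le_iff_positive_diff)
  have "(N + (1 / c)\<^sup>2 *\<^sub>R R - (2 / c) *\<^sub>R 1) + (1 / c)\<^sup>2 *\<^sub>R (c *\<^sub>R 1 - R) =
      N + ((1 / c)\<^sup>2 * c - 2 / c) *\<^sub>R 1"
    by (simp add: algebra_simps)
  also have "(1 / c)\<^sup>2 * c - 2 / c = - (1 / c)"
    using c by (simp add: power2_eq_square)
  finally have eq: "(N + (1 / c)\<^sup>2 *\<^sub>R R - (2 / c) *\<^sub>R 1) + (1 / c)\<^sup>2 *\<^sub>R (c *\<^sub>R 1 - R) =
      N + (- (1 / c)) *\<^sub>R 1" .
  have "positive_op (N - (1 / c) *\<^sub>R 1)"
    using positive_op_add[OF 1 2] unfolding eq by simp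
  then show ?thesis
    using N by (simp add: op_le_iff_positive_diff N_def)
qed

text \<open>The gap is a sum of positive terms: 1/c - N = (1 - c N)^2 / c + N (R - c) N.\<close>

lemma op_inverse_bounded_above:
  assumes R: "positive_op R" and inv: "invertible_op R" and le: "c *\<^sub>R 1 \<preceq> R" and c: "0 < c"
  shows "op_inverse R \<preceq> (1 / c) *\<^sub>R 1"
proof -
  define N where "N = op_inverse R"
  have N: "positive_op N" and RN: "R * N = 1" "N * R = 1"
    using R inv by (simp_all add: N_def)
  have "positive_op (N * (R - c *\<^sub>R 1) * N)"
    using le N by (intro positive_op_sandwich) (auto simp: op_le_iff_positive_diff)
  then have "positive_op ((1 / c) *\<^sub>R ((1 - c *\<^sub>R N) * (1 - c *\<^sub>R N)) + N * (R - c *\<^sub>R 1) * N)"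
    using N c by (intro positive_op_add positive_op_scaleR positive_op_square) simp_all
  also have "(1 / c) *\<^sub>R ((1 - c *\<^sub>R N) * (1 - c *\<^sub>R N)) + N * (R - c *\<^sub>R 1) * N =
      (1 / c) *\<^sub>R 1 - N"
    using c by (simp add: algebra_simps RN)
  finally show ?thesis
    using N by (simp add: op_le_iff_positive_diff N_def)
qed

text \<open>Inversion turns the lower bound into the upper bound N^2 <= 1/m^2, to which
  \<open>bop_le_of_square_le\<close> applies; inverting N <= 1/m back gives the claim.\<close>

lemma bop_ge_of_square_ge:
  fixes R :: "'a::chilbert_space bop"
  assumes R: "positive_op R" and ge: "m\<^sup>2 *\<^sub>R 1 \<preceq> R * R" and m: "0 < m"
  shows "m *\<^sub>R 1 \<preceq> R"
proof -
  have "invertible_op (R * R)"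
    by (rule invertible_op_bounded_below[OF ge zero_less_power[OF m]])
  then have inv: "invertible_op R" by (rule invertible_op_of_square)
  define N where "N = op_inverse R"
  have N: "positive_op N" and RN: "R * N = 1" "N * R = 1"
    using R inv by (simp_all add: N_def)
  have "N * (m\<^sup>2 *\<^sub>R 1) * N \<preceq> N * (R * R) * N"
    using ge N by (intro op_le_sandwich) simp_all
  also have "N * (R * R) * N = (N * R) * (R * N)" by (simp only: mult.assoc)
  finally have "(1 / m\<^sup>2) *\<^sub>R (m\<^sup>2 *\<^sub>R (N * N)) \<preceq> (1 / m\<^sup>2) *\<^sub>R 1"
    using m by (intro op_le_scaleR) (simp_all add: RN)
  then have "N * N \<preceq> (1 / m)\<^sup>2 *\<^sub>R 1" using m by (simp add: power_divide)
  then have le: "N \<preceq> (1 / m) *\<^sub>R 1" using m by (intro bop_le_of_square_le[OF N]) simp_all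
  have "(1 / (1 / m)) *\<^sub>R 1 \<preceq> op_inverse N"
    using m by (intro op_inverse_bounded_below[OF N invertible_opI[OF RN(2,1)] le]) simp
  then show ?thesis by (simp add: op_inverse_eqI[OF RN(2,1)])
qed

text \<open>The inverse is bounded above by its norm, so inverting again bounds R below; the added 1
  keeps the divisor positive.\<close>

lemma positive_invertible_bounded_below:
  assumes R: "positive_op R" and inv: "invertible_op R"
  obtains d where "0 < d" "d *\<^sub>R 1 \<preceq> R"
proof
  let ?c = "norm (op_inverse R) + 1"
  show "0 < 1 / ?c" by (simp add: add_nonneg_pos)
  have "op_inverse R \<preceq> ?c *\<^sub>R 1"
    by (rule op_le_trans[OF bop_le_norm op_le_scaleR_left]) (use R in simp_all)
  then have "(1 / ?c) *\<^sub>R 1 \<preceq> op_inverse (op_inverse R)"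
    using R inv
    by (intro op_inverse_bounded_below) (simp_all add: invertible_op_inverse add_nonneg_pos)
  then show "(1 / ?c) *\<^sub>R 1 \<preceq> R" using inv by (simp add: op_inverse_op_inverse)
qed

lemma invertible_op_mono:
  fixes C P :: "'a::chilbert_space bop"
  assumes C: "positive_op C" "invertible_op C" and le: "C \<preceq> P"
  shows "invertible_op P"
proof -
  obtain d where d: "0 < d" "d *\<^sub>R 1 \<preceq> C"
    using positive_invertible_bounded_below[OF C] by blast
  show ?thesis
    by (rule invertible_op_bounded_below[OF op_le_trans[OF d(2) le] d(1)])
qed

section \<open>Square roots and inverse square roots of invertible operators\<close>

lemma invertible_op_sqrt_iff:
  fixes P :: "'a::chilbert_space bop"
  assumes "positive_op P"
  shows "invertible_op (op_sqrt P) \<longleftrightarrow> invertible_op P"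
  using invertible_op_mult[of "op_sqrt P" "op_sqrt P"] invertible_op_of_square[of "op_sqrt P"] assms
  by auto

lemma op_inv_sqrt_noninvertible:
  fixes P :: "'a::chilbert_space bop"
  shows "positive_op P \<Longrightarrow> \<not> invertible_op P \<Longrightarrow> op_inv_sqrt P = 0"
  by (simp add: op_inv_sqrt_def op_inverse_def invertible_op_sqrt_iff)

lemma positive_op_inv_sqrt [simp]:
  fixes P :: "'a::chilbert_space bop"
  shows "positive_op P \<Longrightarrow> positive_op (op_inv_sqrt P)"
  by (simp add: op_inv_sqrt_def)

lemma
  fixes P :: "'a::chilbert_space bop"
  assumes "positive_op P" "invertible_op P"
  shows op_sqrt_mult_inv_sqrt [simp]: "op_sqrt P * op_inv_sqrt P = 1"
    and op_inv_sqrt_mult_sqrt [simp]: "op_inv_sqrt P * op_sqrt P = 1"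
  using assms by (simp_all add: op_inv_sqrt_def invertible_op_sqrt_iff)


section \<open>The geometric mean\<close>

lemma geometric_mean_noninvertible:
  fixes A B :: "'a::chilbert_space bop"
  assumes "positive_op A" "\<not> invertible_op A"
  shows "A \<sharp> B = 0"
proof -
  have "op_sqrt 0 = (0 :: 'a bop)" by (rule op_sqrt_eqI) simp_all
  then show ?thesis using assms by (simp add: geometric_mean_def op_inv_sqrt_noninvertible)
qed

text \<open>Compression by a sends 1, R and R^2 to A, the mean and B. Inequalities between A, B and
  their mean thus reduce to polynomial inequalities in the single operator R.\<close>

lemma geometric_mean_factorization:
  fixes A B :: "'a::chilbert_space bop"
  assumes A: "positive_op A" "invertible_op A" and B: "positive_op B"
  obtains a n R where "positive_op a" "positive_op n" "a * n = 1" "n * a = 1" "a * a = A"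
    "positive_op R" "R * R = n * B * n" "a * R * (R * a) = B" "A \<sharp> B = a * R * a"
proof
  define a where "a = op_sqrt A"
  define n where "n = op_inv_sqrt A"
  define R where "R = op_sqrt (n * B * n)"
  show an: "a * n = 1" "n * a = 1" and "a * a = A" and a: "positive_op a" and n: "positive_op n"
    using A by (simp_all add: a_def n_def)
  have nBn: "positive_op (n * B * n)" using B n by simp
  then show "positive_op R" and RR: "R * R = n * B * n"
    by (simp_all only: R_def positive_op_sqrt op_sqrt_mult_self)
  have "a * R * (R * a) = a * (R * R) * a" by (simp only: mult.assoc)
  also have "\<dots> = (a * n) * B * (n * a)" by (simp only: RR mult.assoc)
  finally show "a * R * (R * a) = B" by (simp add: an)
  show "A \<sharp> B = a * R * a"
    by (simp only: geometric_mean_def a_def n_def R_def)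
qed

lemma positive_op_geometric_mean [simp]:
  fixes A B :: "'a::chilbert_space bop"
  assumes "positive_op A" "positive_op B"
  shows "positive_op (A \<sharp> B)"
proof (cases "invertible_op A")
  case True
  then show ?thesis
    using assms geometric_mean_factorization[of A B] positive_op_sandwich positive_op_selfadjoint
    by metis
qed (simp add: assms geometric_mean_noninvertible)

text \<open>Compress (R - t)^2 by a. If A is not invertible, the mean is 0 by convention and the
  right-hand side is positive.\<close>

lemma geometric_mean_amgm:
  fixes A B :: "'a::chilbert_space bop"
  assumes A: "positive_op A" and B: "positive_op B"
  shows "(2 * t) *\<^sub>R (A \<sharp> B) \<preceq> t\<^sup>2 *\<^sub>R A + B"
proof (cases "invertible_op A")
  case True
  obtain a n R where a: "positive_op a" "a * a = A" and R: "positive_op R"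
    and B': "a * R * (R * a) = B" and G: "A \<sharp> B = a * R * a"
    using geometric_mean_factorization[OF A True B] by metis
  have "a * ((R - t *\<^sub>R 1) * (R - t *\<^sub>R 1)) * a = t\<^sup>2 *\<^sub>R (a * a) + a * R * (R * a) - (2 * t) *\<^sub>R (a * R * a)"
    by (simp add: algebra_simps power2_eq_square flip: scaleR_2)
  moreover have "positive_op (a * ((R - t *\<^sub>R 1) * (R - t *\<^sub>R 1)) * a)"
    using a R by (intro positive_op_sandwich positive_op_square) simp_all
  ultimately have "positive_op (t\<^sup>2 *\<^sub>R A + B - (2 * t) *\<^sub>R (A \<sharp> B))"
    by (simp only: a B' G)
  then show ?thesis using A B by (simp add: op_le_iff_positive_diff)
next
  case False
  then show ?thesis
    using A B by (simp add: geometric_mean_noninvertible op_le_iff_positive_diff)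
qed

lemma geometric_mean_diaz_metcalf:
  fixes A B :: "'a::chilbert_space bop"
  assumes A: "positive_op A" "invertible_op A" and B: "positive_op B"
    and m: "0 < m" "m < M" and le: "m\<^sup>2 *\<^sub>R A \<preceq> B" "B \<preceq> M\<^sup>2 *\<^sub>R A"
  shows "(M * m) *\<^sub>R A + B \<preceq> (M + m) *\<^sub>R (A \<sharp> B)"
proof -
  obtain a n R where a: "positive_op a" "a * a = A" and n: "positive_op n"
    and an: "a * n = 1" "n * a = 1" and R: "positive_op R" and RR: "R * R = n * B * n"
    and B': "a * R * (R * a) = B" and G: "A \<sharp> B = a * R * a"
    using geometric_mean_factorization[OF A B] by metis
  \<comment> \<open>Congruence by n turns A into 1 and B into R^2, so the hypotheses become scalar
    bounds on R^2.\<close>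
  have "n * A * n = (n * a) * (a * n)" by (simp only: mult.assoc flip: a(2))
  then have nAn: "n * (r *\<^sub>R A) * n = r *\<^sub>R 1" for r by (simp add: an)
  have sn: "selfadjoint n" using n by simp
  have "m\<^sup>2 *\<^sub>R 1 \<preceq> R * R" "R * R \<preceq> M\<^sup>2 *\<^sub>R 1"
    using le[THEN op_le_sandwich, OF sn] by (simp_all only: nAn RR)
  then have "m *\<^sub>R 1 \<preceq> R" "R \<preceq> M *\<^sub>R 1"
    using R m by (auto intro: bop_ge_of_square_ge bop_le_of_square_le)
  \<comment> \<open>The two factors add up to the scalar M - m, which is positive because m <
    M.\<close>
  then have "positive_op ((M *\<^sub>R 1 - R) * (R - m *\<^sub>R 1))"
    using m by (intro positive_op_mult_complementary[where s = "M - m"])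
      (auto simp: op_le_iff_positive_diff algebra_simps)
  then have "positive_op (a * ((M *\<^sub>R 1 - R) * (R - m *\<^sub>R 1)) * a)"
    using a by (intro positive_op_sandwich) simp_all
  also have "a * ((M *\<^sub>R 1 - R) * (R - m *\<^sub>R 1)) * a =
      (M + m) *\<^sub>R (a * R * a) - ((M * m) *\<^sub>R (a * a) + a * R * (R * a))"
    by (simp add: algebra_simps)
  also have "\<dots> = (M + m) *\<^sub>R (A \<sharp> B) - ((M * m) *\<^sub>R A + B)"
    by (simp only: a B' G)
  finally show ?thesis
    using A B by (simp add: op_le_iff_positive_diff)
qed

text \<open>Since the inverse of A is n^2, the inner root is that of n^4, namely n^2, and a n^2 a =
  1.\<close>

lemma geometric_mean_op_inverse:
  fixes A :: "'a::chilbert_space bop"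
  assumes A: "positive_op A" "invertible_op A"
  shows "A \<sharp> op_inverse A = 1"
proof -
  define a where "a = op_sqrt A"
  define n where "n = op_inv_sqrt A"
  have an: "a * n = 1" "n * a = 1" and aa: "a * a = A" and n: "positive_op n"
    using A by (simp_all add: a_def n_def)
  have inv: "op_inverse A = n * n" using op_inverse_square[OF an] by (simp only: aa)
  have "op_sqrt (n * (n * n) * n) = n * n"
    by (rule op_sqrt_eqI) (use n in \<open>simp_all add: mult.assoc\<close>)
  then have "A \<sharp> op_inverse A = (a * n) * (n * a)"
    by (simp only: geometric_mean_def inv mult.assoc flip: a_def n_def)
  then show ?thesis by (simp add: an)
qed

text \<open>The mean G solves the Riccati equation G A^(-1) G = B. As A^(-1) is at least 1/c^2, this
  gives G^2 / c^2 <= B <= d^2.\<close>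

lemma geometric_mean_le_scalar:
  fixes A B :: "'a::chilbert_space bop"
  assumes A: "positive_op A" "invertible_op A" and B: "positive_op B"
    and le: "A \<preceq> c\<^sup>2 *\<^sub>R 1" "B \<preceq> d\<^sup>2 *\<^sub>R 1" and c: "0 < c" "0 < d"
  shows "A \<sharp> B \<preceq> (c * d) *\<^sub>R 1"
proof (rule bop_le_of_square_le)
  obtain a n R where a: "positive_op a" "a * a = A" and an: "a * n = 1" "n * a = 1"
    and B': "a * R * (R * a) = B" and G: "A \<sharp> B = a * R * a"
    using geometric_mean_factorization[OF A B] by metis
  have inv: "op_inverse A = n * n" using op_inverse_square[OF an] by (simp only: a)
  show "positive_op (A \<sharp> B)" using A B by simp
  then have sG: "selfadjoint (A \<sharp> B)" by simp
  have "(1 / c\<^sup>2) *\<^sub>R 1 \<preceq> op_inverse A"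
    using A le c by (intro op_inverse_bounded_below) simp_all
  then have "(A \<sharp> B) * ((1 / c\<^sup>2) *\<^sub>R 1) * (A \<sharp> B) \<preceq> (A \<sharp> B) * op_inverse A * (A \<sharp> B)"
    using sG by (rule op_le_sandwich)
  also have "(A \<sharp> B) * op_inverse A * (A \<sharp> B) = a * R * ((a * n) * (n * a)) * (R * a)"
    by (simp only: G inv mult.assoc)
  also have "\<dots> = B" by (simp add: an B')
  finally have "(A \<sharp> B) * ((1 / c\<^sup>2) *\<^sub>R 1) * (A \<sharp> B) \<preceq> d\<^sup>2 *\<^sub>R 1"
    using le(2) by (rule op_le_trans)
  from op_le_scaleR[OF this, of "c\<^sup>2"] show "(A \<sharp> B) * (A \<sharp> B) \<preceq> (c * d)\<^sup>2 *\<^sub>R 1"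
    using c by (simp add: power_mult_distrib)
qed (use c in simp)

text \<open>Congruence by C^(-1/2) turns \<open>dm\<close> into M m X + Z <= M + m, where X has
  inverse Y. Subtracting 2 sqrt (M m) <= Y + M m X bounds Z - Y by M + m - 2 sqrt (M m). The bound
  \<open>CP\<close> passes invertibility from C to P.\<close>

lemma klamkin_mclenaghan_of_diaz_metcalf:
  fixes P Q C :: "'a::chilbert_space bop"
  assumes P: "positive_op P" and Q: "positive_op Q" and C: "positive_op C"
    and m: "0 < m" "0 < M" and k: "0 < k" and CP: "C \<preceq> k *\<^sub>R P"
    and dm: "(M * m) *\<^sub>R P + Q \<preceq> (M + m) *\<^sub>R C"
  shows "op_inv_sqrt C * Q * op_inv_sqrt C - op_sqrt C * op_inverse P * op_sqrt C
      \<preceq> (sqrt M - sqrt m)\<^sup>2 *\<^sub>R 1"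
proof (cases "invertible_op C")
  \<comment> \<open>Here the inverse root of C is 0 by convention, so only minus a positive operator
    remains on the left.\<close>
  case False
  then show ?thesis
    using C P by (simp add: op_inv_sqrt_noninvertible op_le_iff_positive_diff)
next
  case True
  have "invertible_op ((1 / k) *\<^sub>R (k *\<^sub>R P))"
    using k by (intro invertible_op_scaleR[OF invertible_op_mono[OF C True CP]]) simp
  then have Pinv: "invertible_op P" using k by simp
  define c where "c = op_sqrt C"
  define e where "e = op_inv_sqrt C"
  have ce: "c * e = 1" "e * c = 1" and cc: "c * c = C"
    and c: "positive_op c" and e: "positive_op e"
    using C True by (simp_all add: c_def e_def)
  define X where "X = e * P * e"
  define Y where "Y = c * op_inverse P * c"
  define Z where "Z = e * Q * e"
  have X: "positive_op X" and Y: "positive_op Y" and Z: "positive_op Z"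
    using P Q c e by (simp_all add: X_def Y_def Z_def)
  have "X * Y = e * P * (e * c) * op_inverse P * c" "Y * X = c * op_inverse P * (c * e) * P * e"
    by (simp_all only: X_def Y_def mult.assoc)
  then have XY: "X * Y = 1" "Y * X = 1"
    using Pinv by (simp_all add: ce mult.assoc)
  have "e * C * e = (e * c) * (c * e)" by (simp only: mult.assoc flip: cc)
  then have "e * ((M + m) *\<^sub>R C) * e = (M + m) *\<^sub>R 1" by (simp add: ce)
  moreover have "e * ((M * m) *\<^sub>R P + Q) * e = (M * m) *\<^sub>R X + Z"
    by (simp add: X_def Z_def distrib_left distrib_right)
  ultimately have 1: "(M * m) *\<^sub>R X + Z \<preceq> (M + m) *\<^sub>R 1"
    using op_le_sandwich[OF dm positive_op_selfadjoint[OF e]] by (simp only:)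
  have 2: "(2 * sqrt (M * m)) *\<^sub>R 1 \<preceq> Y + (M * m) *\<^sub>R X"
    using op_inverse_amgm[OF X Y XY, of "sqrt (M * m)"] m by simp
  have eq: "(sqrt M - sqrt m)\<^sup>2 = (M + m) - 2 * sqrt (M * m)"
    using m by (simp add: power2_diff real_sqrt_mult)
  have "(sqrt M - sqrt m)\<^sup>2 *\<^sub>R 1 - (Z - Y) =
      ((M + m) *\<^sub>R 1 - ((M * m) *\<^sub>R X + Z)) + (Y + (M * m) *\<^sub>R X - (2 * sqrt (M * m)) *\<^sub>R 1)"
    unfolding eq by (simp add: algebra_simps)
  moreover have "positive_op \<dots>"
    using 1 2 by (intro positive_op_add) (auto simp: op_le_iff_positive_diff)
  ultimately have "positive_op ((sqrt M - sqrt m)\<^sup>2 *\<^sub>R 1 - (Z - Y))"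
    by (simp only:)
  then have "Z - Y \<preceq> (sqrt M - sqrt m)\<^sup>2 *\<^sub>R 1"
    using Y Z by (simp add: op_le_iff_positive_diff)
  then show ?thesis by (simp only: X_def Y_def Z_def c_def e_def)
qed


section \<open>Positive linear maps\<close>

lemma positive_linear_map_positive [simp]:
  "positive_linear_map \<Phi> \<Longrightarrow> positive_op X \<Longrightarrow> positive_op (\<Phi> X)"
  by (simp add: positive_linear_map_def)

lemma positive_linear_map_add: "positive_linear_map \<Phi> \<Longrightarrow> \<Phi> (X + Y) = \<Phi> X + \<Phi> Y"
  by (simp add: positive_linear_map_def)

lemma positive_linear_map_scaleR: "positive_linear_map \<Phi> \<Longrightarrow> \<Phi> (r *\<^sub>R X) = r *\<^sub>R \<Phi> X"
  by (simp add: positive_linear_map_def scaleR_scaleC)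

text \<open>Positivity of X supplies the self-adjointness of its image, which
  \<open>\<preceq>\<close> includes.\<close>

lemma positive_linear_map_mono:
  assumes \<Phi>: "positive_linear_map \<Phi>" and le: "X \<preceq> Y" and X: "positive_op X"
  shows "\<Phi> X \<preceq> \<Phi> Y"
proof -
  have "\<Phi> Y = \<Phi> X + \<Phi> (Y - X)"
    by (simp flip: positive_linear_map_add[OF \<Phi>])
  moreover have "positive_op (\<Phi> (Y - X))"
    using \<Phi> le by (simp add: op_le_iff_positive_diff)
  ultimately show ?thesis
    using \<Phi> X by (simp add: op_le_iff_positive_diff)
qed

section \<open>Inequalities of the first type for a fixed pair of operators\<close>

context
  fixes A B :: "'h::chilbert_space bop"
    and \<Phi> :: "'h bop \<Rightarrow> 'k::chilbert_space bop"
    and m M :: real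
  assumes A: "positive_op A" "invertible_op A" and B: "positive_op B"
    and \<Phi>: "positive_linear_map \<Phi>"
    and m: "0 < m" "m < M" and le: "m\<^sup>2 *\<^sub>R A \<preceq> B" "B \<preceq> M\<^sup>2 *\<^sub>R A"
begin

lemma operator_diaz_metcalf: "(M * m) *\<^sub>R \<Phi> A + \<Phi> B \<preceq> (M + m) *\<^sub>R \<Phi> (A \<sharp> B)"
proof -
  have "\<Phi> ((M * m) *\<^sub>R A + B) \<preceq> \<Phi> ((M + m) *\<^sub>R (A \<sharp> B))"
    using A B m
    by (intro positive_linear_map_mono[OF \<Phi> geometric_mean_diaz_metcalf[OF A B m le]]) simp_all
  then show ?thesis
    by (simp add: positive_linear_map_add[OF \<Phi>] positive_linear_map_scaleR[OF \<Phi>])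
qed

lemma operator_cassels: "\<Phi> A \<sharp> \<Phi> B \<preceq> ((M + m) / (2 * sqrt (M * m))) *\<^sub>R \<Phi> (A \<sharp> B)"
proof -
  \<comment> \<open>With this t the upper bound of the arithmetic-geometric mean inequality is
    exactly the left-hand side of Diaz-Metcalf.\<close>
  define t where "t = sqrt (M * m)"
  have t: "0 < t" "t\<^sup>2 = M * m" using m by (simp_all add: t_def)
  have "(2 * t) *\<^sub>R (\<Phi> A \<sharp> \<Phi> B) \<preceq> t\<^sup>2 *\<^sub>R \<Phi> A + \<Phi> B"
    using A B \<Phi> by (intro geometric_mean_amgm) simp_all
  also note t(2)
  finally have "(2 * t) *\<^sub>R (\<Phi> A \<sharp> \<Phi> B) \<preceq> (M + m) *\<^sub>R \<Phi> (A \<sharp> B)"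
    using operator_diaz_metcalf by (rule op_le_trans)
  then have "(1 / (2 * t)) *\<^sub>R (2 * t) *\<^sub>R (\<Phi> A \<sharp> \<Phi> B) \<preceq> (1 / (2 * t)) *\<^sub>R (M + m) *\<^sub>R \<Phi> (A \<sharp> B)"
    using t by (intro op_le_scaleR) simp_all
  then show ?thesis using t by (simp add: t_def[symmetric])
qed

lemma operator_klamkin_mclenaghan:
  "op_inv_sqrt (\<Phi> (A \<sharp> B)) * \<Phi> B * op_inv_sqrt (\<Phi> (A \<sharp> B))
     - op_sqrt (\<Phi> (A \<sharp> B)) * op_inverse (\<Phi> A) * op_sqrt (\<Phi> (A \<sharp> B))
   \<preceq> ((sqrt M - sqrt m)\<^sup>2) *\<^sub>R 1"
\<comment> \<open>The constant comes from 2 (A \<open>\<sharp>\<close> B) <= A + B <= (1 + M^2)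
  A.\<close>
proof (rule klamkin_mclenaghan_of_diaz_metcalf[where k = "(1 + M\<^sup>2) / 2"])
  have "(2 * 1) *\<^sub>R (A \<sharp> B) \<preceq> 1\<^sup>2 *\<^sub>R A + B"
    using A B by (intro geometric_mean_amgm)
  also have "1\<^sup>2 *\<^sub>R A + B \<preceq> A + M\<^sup>2 *\<^sub>R A"
    using A le by (simp add: op_le_iff_positive_diff)
  finally (op_le_trans) have "(1 / 2) *\<^sub>R (2 * 1) *\<^sub>R (A \<sharp> B) \<preceq> (1 / 2) *\<^sub>R (A + M\<^sup>2 *\<^sub>R A)"
    by (intro op_le_scaleR) simp_all
  then have "A \<sharp> B \<preceq> ((1 + M\<^sup>2) / 2) *\<^sub>R A"
    by (simp add: algebra_simps add_divide_distrib)
  then have "\<Phi> (A \<sharp> B) \<preceq> \<Phi> (((1 + M\<^sup>2) / 2) *\<^sub>R A)"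
    using A B by (intro positive_linear_map_mono[OF \<Phi>]) simp_all
  then show "\<Phi> (A \<sharp> B) \<preceq> ((1 + M\<^sup>2) / 2) *\<^sub>R \<Phi> A"
    by (simp add: positive_linear_map_scaleR[OF \<Phi>])
  show "(M * m) *\<^sub>R \<Phi> A + \<Phi> B \<preceq> (M + m) *\<^sub>R \<Phi> (A \<sharp> B)"
    by (rule operator_diaz_metcalf)
qed (use A B \<Phi> m in \<open>simp_all add: add_pos_nonneg\<close>)

end

section \<open>Kantorovich and Gruess bounds for maps with
  \<open>\<Phi> 1 \<preceq> 1\<close>\<close>

lemma operator_kantorovich:
  fixes A :: "'h::chilbert_space bop"
    and \<Phi> :: "'h bop \<Rightarrow> 'k::chilbert_space bop"
  assumes A: "positive_op A" "invertible_op A" and \<Phi>: "positive_linear_map \<Phi>" "\<Phi> 1 \<preceq> 1"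
    and m: "0 < m" "m < M"
    and le: "m\<^sup>2 *\<^sub>R A \<preceq> op_inverse A" "op_inverse A \<preceq> M\<^sup>2 *\<^sub>R A"
  shows "\<Phi> A \<sharp> \<Phi> (op_inverse A) \<preceq> ((M + m) / (2 * sqrt (M * m))) *\<^sub>R 1"
proof -
  have "\<Phi> A \<sharp> \<Phi> (op_inverse A) \<preceq> ((M + m) / (2 * sqrt (M * m))) *\<^sub>R \<Phi> (A \<sharp> op_inverse A)"
    using A \<Phi> m le by (intro operator_cassels) simp_all
  also have "\<Phi> (A \<sharp> op_inverse A) = \<Phi> 1" by (simp only: geometric_mean_op_inverse[OF A])
  also have "((M + m) / (2 * sqrt (M * m))) *\<^sub>R \<Phi> 1 \<preceq> ((M + m) / (2 * sqrt (M * m))) *\<^sub>R 1"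
    using m \<Phi>(2) by (intro op_le_scaleR) simp_all
  finally (op_le_trans) show ?thesis .
qed

text \<open>Two readings of the bounds are covered. Bounds on A itself yield relative bounds with
  1/M^2 and 1/m^2, whose Cassels constant is exactly the stated one; under relative bounds with m
  and M the Cassels constant is at most the stated one.\<close>

lemma operator_kantorovich_bounds:
  fixes A :: "'h::chilbert_space bop"
    and \<Phi> :: "'h bop \<Rightarrow> 'k::chilbert_space bop"
  assumes A: "positive_op A" "invertible_op A" and \<Phi>: "positive_linear_map \<Phi>" "\<Phi> 1 \<preceq> 1"
    and m: "0 < m" "m < M"
    and le: "m\<^sup>2 *\<^sub>R 1 \<preceq> A \<and> A \<preceq> M\<^sup>2 *\<^sub>R 1 \<or>
      m\<^sup>2 *\<^sub>R A \<preceq> op_inverse A \<and> op_inverse A \<preceq> M\<^sup>2 *\<^sub>R A"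
  shows "\<Phi> A \<sharp> \<Phi> (op_inverse A) \<preceq> ((M\<^sup>2 + m\<^sup>2) / (2 * M * m)) *\<^sub>R 1"
  using le
proof (elim disjE conjE)
  assume le: "m\<^sup>2 *\<^sub>R 1 \<preceq> A" "A \<preceq> M\<^sup>2 *\<^sub>R 1"
  define k where "k = 1 / M\<^sup>2"
  define K where "K = 1 / m\<^sup>2"
  have K: "0 < k" "k < K"
    using m by (simp_all add: k_def K_def frac_less2 power_strict_mono)
  \<comment> \<open>The scalar k separates the two operators: k^2 A <= k^2 M^2 = k <= A^(-1). The
    upper bound uses K in the same way.\<close>
  have "k\<^sup>2 *\<^sub>R A \<preceq> k\<^sup>2 *\<^sub>R M\<^sup>2 *\<^sub>R 1" using le(2) by (rule op_le_scaleR) simp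
  also have "k\<^sup>2 *\<^sub>R M\<^sup>2 *\<^sub>R 1 = k *\<^sub>R (1 :: 'h bop)"
    using m by (simp add: k_def power2_eq_square)
  also have "k *\<^sub>R 1 \<preceq> op_inverse A"
    unfolding k_def using m by (intro op_inverse_bounded_below A le) simp
  finally (op_le_trans) have lower: "k\<^sup>2 *\<^sub>R A \<preceq> op_inverse A" .
  have "op_inverse A \<preceq> K *\<^sub>R 1"
    unfolding K_def using m by (intro op_inverse_bounded_above A le) simp
  also have "K *\<^sub>R 1 = K\<^sup>2 *\<^sub>R m\<^sup>2 *\<^sub>R (1 :: 'h bop)"
    using m by (simp add: K_def power2_eq_square)
  also have "K\<^sup>2 *\<^sub>R m\<^sup>2 *\<^sub>R 1 \<preceq> K\<^sup>2 *\<^sub>R A" using le(1) by (rule op_le_scaleR) simp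
  finally (op_le_trans) have upper: "op_inverse A \<preceq> K\<^sup>2 *\<^sub>R A" .
  have "sqrt (K * k) = 1 / (M * m)"
    using m by (simp add: K_def k_def real_sqrt_divide real_sqrt_mult)
  then have "(K + k) / (2 * sqrt (K * k)) = (M\<^sup>2 + m\<^sup>2) / (2 * M * m)"
    using m by (simp add: K_def k_def field_simps power2_eq_square)
  then show ?thesis
    using operator_kantorovich[OF A \<Phi> K lower upper] by simp
next
  assume le: "m\<^sup>2 *\<^sub>R A \<preceq> op_inverse A" "op_inverse A \<preceq> M\<^sup>2 *\<^sub>R A"
  define t where "t = sqrt (M * m)"
  have t: "0 < t" "t * t = M * m" using m by (simp_all add: t_def)
  \<comment> \<open>The comparison of constants is (M + m) t <= (M + m)^2 / 2 <= M^2 + m^2, divided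
    by 2 t^2 = 2 M m.\<close>
  have "t \<le> (M + m) / 2" unfolding t_def using m by (intro arith_geo_mean_sqrt) simp_all
  then have "(M + m) * t \<le> (M + m) * ((M + m) / 2)" using m by (intro mult_left_mono) simp_all
  also have "\<dots> \<le> M\<^sup>2 + m\<^sup>2"
    using zero_le_power2[of "M - m"] by (simp add: power2_eq_square algebra_simps)
  finally have "(M + m) * t / (2 * (t * t)) \<le> (M\<^sup>2 + m\<^sup>2) / (2 * (t * t))"
    using t(1) by (intro divide_right_mono) simp_all
  then have "(M + m) / (2 * t) \<le> (M\<^sup>2 + m\<^sup>2) / (2 * M * m)"
    using t(1) by (simp add: t(2) mult.assoc) (simp add: t(2)[symmetric])
  then have "((M + m) / (2 * t)) *\<^sub>R 1 \<preceq> ((M\<^sup>2 + m\<^sup>2) / (2 * M * m)) *\<^sub>R (1 :: 'k bop)"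
    by (intro op_le_scaleR_left) simp_all
  then show ?thesis
    using operator_kantorovich[OF A \<Phi> m le] unfolding t_def by (rule op_le_trans[rotated])
qed

text \<open>Subtracting G = \<open>\<Phi> (A \<sharp> B)\<close> from the Polya-Szego bound leaves
  (k - 1) G with k - 1 = (u - v)^2 / (2 u v), and G is at most u^2 = M1 M2.\<close>

lemma operator_gruess:
  fixes A B :: "'h::chilbert_space bop"
    and \<Phi> :: "'h bop \<Rightarrow> 'k::chilbert_space bop"
  assumes A: "positive_op A" "invertible_op A" and B: "positive_op B"
    and \<Phi>: "positive_linear_map \<Phi>" "\<Phi> 1 \<preceq> 1"
    and m: "0 < m1" "m1 < M1" "0 < m2" "m2 < M2"
    and le: "A \<preceq> M1\<^sup>2 *\<^sub>R 1" "B \<preceq> M2\<^sup>2 *\<^sub>R 1"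
    and ps: "\<Phi> A \<sharp> \<Phi> B
      \<preceq> ((1 / 2) * (sqrt ((M1 * M2) / (m1 * m2)) + sqrt ((m1 * m2) / (M1 * M2)))) *\<^sub>R \<Phi> (A \<sharp> B)"
  shows "\<Phi> A \<sharp> \<Phi> B - \<Phi> (A \<sharp> B)
    \<preceq> (sqrt (M1 * M2) * (sqrt (M1 * M2) - sqrt (m1 * m2))\<^sup>2
        / (2 * sqrt (m1 * m2)) * min (M1 / m1) (M2 / m2)) *\<^sub>R 1"
proof -
  define u where "u = sqrt (M1 * M2)"
  define v where "v = sqrt (m1 * m2)"
  have uv: "0 < u" "0 < v" "u\<^sup>2 = M1 * M2" using m by (simp_all add: u_def v_def)
  define k where "k = (1 / 2) * (u / v + v / u)"
  have k: "k - 1 = (u - v)\<^sup>2 / (2 * u * v)"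
    using uv by (simp add: k_def field_simps power2_eq_square)
  then have k0: "0 \<le> k - 1" using uv by simp
  define G where "G = \<Phi> (A \<sharp> B)"
  have pG: "positive_op G" using A B \<Phi> by (simp add: G_def)
  have "\<Phi> A \<sharp> \<Phi> B \<preceq> k *\<^sub>R G"
    using ps by (simp add: k_def u_def v_def G_def real_sqrt_divide)
  then have "\<Phi> A \<sharp> \<Phi> B - G \<preceq> (k - 1) *\<^sub>R G"
    using pG by (simp add: op_le_iff_positive_diff algebra_simps)
  also have "G \<preceq> (M1 * M2) *\<^sub>R 1"
  proof -
    have "A \<sharp> B \<preceq> (M1 * M2) *\<^sub>R 1"
      using m by (intro geometric_mean_le_scalar[OF A B le]) simp_all
    from positive_linear_map_mono[OF \<Phi>(1) this] have "G \<preceq> \<Phi> ((M1 * M2) *\<^sub>R 1)"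
      using A B by (simp add: G_def)
    also have "\<Phi> ((M1 * M2) *\<^sub>R 1) = (M1 * M2) *\<^sub>R \<Phi> 1"
      by (rule positive_linear_map_scaleR[OF \<Phi>(1)])
    also have "(M1 * M2) *\<^sub>R \<Phi> 1 \<preceq> (M1 * M2) *\<^sub>R 1"
      using m by (intro op_le_scaleR[OF \<Phi>(2)]) simp
    finally (op_le_trans) show ?thesis .
  qed
  from op_le_scaleR[OF this k0] have "(k - 1) *\<^sub>R G \<preceq> ((k - 1) * u\<^sup>2) *\<^sub>R 1"
    by (simp add: uv)
  finally (op_le_trans) have "\<Phi> A \<sharp> \<Phi> B - G \<preceq> ((k - 1) * u\<^sup>2) *\<^sub>R 1" .
  moreover have "(k - 1) * u\<^sup>2 \<le> u * (u - v)\<^sup>2 / (2 * v) * min (M1 / m1) (M2 / m2)"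
  proof -
    \<comment> \<open>What has been shown is the bound without the minimum; both quotients exceed 1,
      so that factor only enlarges it.\<close>
    have "(k - 1) * u\<^sup>2 = u * (u - v)\<^sup>2 / (2 * v) * 1"
      unfolding k using uv(1,2) by (simp add: power2_eq_square)
    also have "\<dots> \<le> u * (u - v)\<^sup>2 / (2 * v) * min (M1 / m1) (M2 / m2)"
      using m uv by (intro mult_left_mono) simp_all
    finally show ?thesis .
  qed
  ultimately have "\<Phi> A \<sharp> \<Phi> B - G \<preceq> (u * (u - v)\<^sup>2 / (2 * v) * min (M1 / m1) (M2 / m2)) *\<^sub>R 1"
    by (rule op_le_trans[OF _ op_le_scaleR_left[OF positive_op_1]])
  then show ?thesis by (simp only: u_def v_def G_def)
qed

section \<open>Assembly of both types\<close>

theorem theorem2p1: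
  fixes A B :: "'h::chilbert_space bop"
    and \<Phi> :: "'h bop \<Rightarrow> 'k::chilbert_space bop"
  assumes "positive_op A" and "invertible_op A"
    and "positive_op B" and "invertible_op B"
    and "positive_linear_map \<Phi>"
  shows
    "(\<forall>m M :: real. 0 < m \<and> m < M \<longrightarrow>
        (m\<^sup>2 *\<^sub>R A \<preceq> B \<and> B \<preceq> M\<^sup>2 *\<^sub>R A \<longrightarrow>
           (M * m) *\<^sub>R \<Phi> A + \<Phi> B \<preceq> (M + m) *\<^sub>R \<Phi> (A \<sharp> B)
         \<and> \<Phi> A \<sharp> \<Phi> B \<preceq> ((M + m) / (2 * sqrt (M * m))) *\<^sub>R \<Phi> (A \<sharp> B)
         \<and> op_inv_sqrt (\<Phi> (A \<sharp> B)) * \<Phi> B * op_inv_sqrt (\<Phi> (A \<sharp> B))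
             - op_sqrt (\<Phi> (A \<sharp> B)) * op_inverse (\<Phi> A) * op_sqrt (\<Phi> (A \<sharp> B))
             \<preceq> ((sqrt M - sqrt m)\<^sup>2) *\<^sub>R 1)
      \<and> (\<Phi> 1 \<preceq> 1
           \<and> (m\<^sup>2 *\<^sub>R 1 \<preceq> A \<and> A \<preceq> M\<^sup>2 *\<^sub>R 1
              \<or> B = op_inverse A \<and> m\<^sup>2 *\<^sub>R A \<preceq> B \<and> B \<preceq> M\<^sup>2 *\<^sub>R A) \<longrightarrow>
           \<Phi> A \<sharp> \<Phi> (op_inverse A) \<preceq> ((M\<^sup>2 + m\<^sup>2) / (2 * M * m)) *\<^sub>R 1))
   \<and> (\<forall>m1 M1 m2 M2 :: real.
        0 < m1 \<and> m1 < M1 \<and> 0 < m2 \<and> m2 < M2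
        \<and> m1\<^sup>2 *\<^sub>R 1 \<preceq> A \<and> A \<preceq> M1\<^sup>2 *\<^sub>R 1
        \<and> m2\<^sup>2 *\<^sub>R 1 \<preceq> B \<and> B \<preceq> M2\<^sup>2 *\<^sub>R 1 \<longrightarrow>
           ((M2 * m2) / (M1 * m1)) *\<^sub>R \<Phi> A + \<Phi> B
             \<preceq> (M2 / m1 + m2 / M1) *\<^sub>R \<Phi> (A \<sharp> B)
         \<and> \<Phi> A \<sharp> \<Phi> B
             \<preceq> ((1 / 2) * (sqrt ((M1 * M2) / (m1 * m2)) + sqrt ((m1 * m2) / (M1 * M2))))
                  *\<^sub>R \<Phi> (A \<sharp> B)
         \<and> op_inv_sqrt (\<Phi> (A \<sharp> B)) * \<Phi> B * op_inv_sqrt (\<Phi> (A \<sharp> B))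
             - op_sqrt (\<Phi> (A \<sharp> B)) * op_inverse (\<Phi> A) * op_sqrt (\<Phi> (A \<sharp> B))
             \<preceq> ((sqrt (M2 / m1) - sqrt (m2 / M1))\<^sup>2) *\<^sub>R 1
         \<and> (\<Phi> 1 \<preceq> 1 \<longrightarrow>
             \<Phi> A \<sharp> \<Phi> B - \<Phi> (A \<sharp> B)
               \<preceq> (sqrt (M1 * M2) * (sqrt (M1 * M2) - sqrt (m1 * m2))\<^sup>2
                    / (2 * sqrt (m1 * m2)) * min (M1 / m1) (M2 / m2)) *\<^sub>R 1))"
proof (intro conjI allI impI; elim conjE)
  note A = assms(1,2) and B = assms(3) and \<Phi> = assms(5)
  fix m M :: real
  assume m: "0 < m" "m < M"
  {
    assume le: "m\<^sup>2 *\<^sub>R A \<preceq> B" "B \<preceq> M\<^sup>2 *\<^sub>R A"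
    note hyps = A B \<Phi> m le
    show "(M * m) *\<^sub>R \<Phi> A + \<Phi> B \<preceq> (M + m) *\<^sub>R \<Phi> (A \<sharp> B)"
      by (rule operator_diaz_metcalf[OF hyps])
    show "\<Phi> A \<sharp> \<Phi> B \<preceq> ((M + m) / (2 * sqrt (M * m))) *\<^sub>R \<Phi> (A \<sharp> B)"
      by (rule operator_cassels[OF hyps])
    show "op_inv_sqrt (\<Phi> (A \<sharp> B)) * \<Phi> B * op_inv_sqrt (\<Phi> (A \<sharp> B))
        - op_sqrt (\<Phi> (A \<sharp> B)) * op_inverse (\<Phi> A) * op_sqrt (\<Phi> (A \<sharp> B))
        \<preceq> ((sqrt M - sqrt m)\<^sup>2) *\<^sub>R 1"
      by (rule operator_klamkin_mclenaghan[OF hyps])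
  next
    assume "\<Phi> 1 \<preceq> 1"
      and "m\<^sup>2 *\<^sub>R 1 \<preceq> A \<and> A \<preceq> M\<^sup>2 *\<^sub>R 1
        \<or> B = op_inverse A \<and> m\<^sup>2 *\<^sub>R A \<preceq> B \<and> B \<preceq> M\<^sup>2 *\<^sub>R A"
    then show "\<Phi> A \<sharp> \<Phi> (op_inverse A) \<preceq> ((M\<^sup>2 + m\<^sup>2) / (2 * M * m)) *\<^sub>R 1"
      by (intro operator_kantorovich_bounds A \<Phi> m) auto
  }
next
  note A = assms(1,2) and B = assms(3) and \<Phi> = assms(5)
  fix m1 M1 m2 M2 :: real
  assume m: "0 < m1" "m1 < M1" "0 < m2" "m2 < M2"
    and leA: "m1\<^sup>2 *\<^sub>R 1 \<preceq> A" "A \<preceq> M1\<^sup>2 *\<^sub>R 1"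
    and leB: "m2\<^sup>2 *\<^sub>R 1 \<preceq> B" "B \<preceq> M2\<^sup>2 *\<^sub>R 1"
  define m where "m = m2 / M1"
  define M where "M = M2 / m1"
  have mM: "0 < m" "m < M"
    using m by (simp_all add: m_def M_def frac_less)
  \<comment> \<open>Scalars again separate the operators: m^2 A <= m^2 M1^2 = m2^2 <= B, and B <=
    M2^2 = M^2 m1^2 <= M^2 A.\<close>
  have "m\<^sup>2 *\<^sub>R A \<preceq> m\<^sup>2 *\<^sub>R M1\<^sup>2 *\<^sub>R 1" using leA(2) by (rule op_le_scaleR) simp
  also have "m\<^sup>2 *\<^sub>R M1\<^sup>2 *\<^sub>R 1 = m2\<^sup>2 *\<^sub>R (1 :: 'h bop)"
    using m by (simp add: m_def power_divide)
  also note leB(1)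
  finally (op_le_trans) have lower: "m\<^sup>2 *\<^sub>R A \<preceq> B" .
  note leB(2)
  also have "M2\<^sup>2 *\<^sub>R 1 = M\<^sup>2 *\<^sub>R m1\<^sup>2 *\<^sub>R (1 :: 'h bop)"
    using m by (simp add: M_def power_divide)
  also have "M\<^sup>2 *\<^sub>R m1\<^sup>2 *\<^sub>R 1 \<preceq> M\<^sup>2 *\<^sub>R A" using leA(1) by (rule op_le_scaleR) simp
  finally (op_le_trans) have upper: "B \<preceq> M\<^sup>2 *\<^sub>R A" .
  note hyps = A B \<Phi> mM lower upper
  show "((M2 * m2) / (M1 * m1)) *\<^sub>R \<Phi> A + \<Phi> B \<preceq> (M2 / m1 + m2 / M1) *\<^sub>R \<Phi> (A \<sharp> B)"
    using operator_diaz_metcalf[OF hyps] by (simp add: m_def M_def mult.commute)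
  \<comment> \<open>The Cassels constant depends only on the ratio M / m, which here is M1 M2 / (m1
    m2).\<close>
  have coeff: "(M + m) / (2 * sqrt (M * m)) = (1 / 2) * (sqrt (M / m) + sqrt (m / M))"
  proof -
    have "M = sqrt M * sqrt M" "m = sqrt m * sqrt m" using mM by simp_all
    moreover have "0 < sqrt M" "0 < sqrt m" using mM by simp_all
    ultimately show ?thesis
      by (simp add: real_sqrt_divide real_sqrt_mult field_simps)
  qed
  have ratio: "M / m = (M1 * M2) / (m1 * m2)" "m / M = (m1 * m2) / (M1 * M2)"
    by (simp_all add: m_def M_def mult.commute)
  show polya_szego: "\<Phi> A \<sharp> \<Phi> B
      \<preceq> ((1 / 2) * (sqrt ((M1 * M2) / (m1 * m2)) + sqrt ((m1 * m2) / (M1 * M2)))) *\<^sub>R \<Phi> (A \<sharp> B)"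
    using operator_cassels[OF hyps] by (simp only: coeff ratio)
  show "op_inv_sqrt (\<Phi> (A \<sharp> B)) * \<Phi> B * op_inv_sqrt (\<Phi> (A \<sharp> B))
      - op_sqrt (\<Phi> (A \<sharp> B)) * op_inverse (\<Phi> A) * op_sqrt (\<Phi> (A \<sharp> B))
      \<preceq> ((sqrt (M2 / m1) - sqrt (m2 / M1))\<^sup>2) *\<^sub>R 1"
    using operator_klamkin_mclenaghan[OF hyps] by (simp only: m_def M_def)
  show "\<Phi> A \<sharp> \<Phi> B - \<Phi> (A \<sharp> B)
      \<preceq> (sqrt (M1 * M2) * (sqrt (M1 * M2) - sqrt (m1 * m2))\<^sup>2
          / (2 * sqrt (m1 * m2)) * min (M1 / m1) (M2 / m2)) *\<^sub>R 1" if "\<Phi> 1 \<preceq> 1"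
    by (rule operator_gruess[OF A B \<Phi> that m leA(2) leB(2) polya_szego])
qed

end
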